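(* Assume that the first variational equation $\mathrm{VE}_1$ of a Hamiltonian system along a particular solution has virtually Abelian differential Galois group, and consider the tower of Picard-Vessiot extensions $$K\subset \mathrm{PV}(\mathrm{VE}_1)\subset \mathrm{PV}(\mathrm{VE}_2)\subset\cdots\subset \mathrm{PV}(\mathrm{VE}_p)\subset \mathrm{PV}(\mathrm{VE}_{p+1})\subset\cdots .$$ Then for every integer $p\ge1$: (1) in the tower $K\subset \mathrm{PV}(\mathrm{VE}_p)\subset \mathrm{PV}(\mathrm{VE}_{p+1})$, the extension $\mathrm{PV}(\mathrm{VE}_p)\subset \mathrm{PV}(\mathrm{VE}_{p+1})$ is generated by second level integrals; (2) $\mathrm{PV}(\mathrm{VE}_p)$ is a solvable Picard-Vessiot extension of $K$.
   Context: Let $\dot x=v(x)$ be the system of canonical Hamilton equations with holomorphic right-hand side on an open subset of $\mathbb{C}^{2n}$, and $x_0(t)$ a particular solution. Substituting $x=x_0(t)+\varepsilon x_1+\frac1{2!}\varepsilon^2x_2+\frac1{3!}\varepsilon^3x_3+\cdots$ and comparing coefficients of powers of the formal parameter $\varepsilon$ gives a chain of equations $\dot x_p=Ax_p+f_p(x_1,\dots,x_{p-1})$, $p=1,2,\dots$, where $A=\frac{\partial v}{\partial x}(x_0(t))$, $f_1=0$, and $f_p$ is polynomial in the components of $x_1,\dots,x_{p-1}$. $K$ is a differential field of characteristic $0$ with constant field $\mathbb{C}$ containing all the coefficients of these equations (the partial derivatives of $v$ evaluated along $x_0(t)$), so $A\in\mathfrak{sp}(2n,K)$. $\mathrm{VE}_p$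 denotes the system formed by the first $p$ equations of the chain, and $\mathrm{PV}(\mathrm{VE}_p)$ is the Picard-Vessiot extension of $K$ (with constants $\mathbb{C}$) generated by the components of all its solutions $(x_1,\dots,x_p)$. A linear algebraic group is virtually Abelian if its identity component is Abelian. A Picard-Vessiot extension is called solvable if the identity component of its differential Galois group is solvable. For a Picard-Vessiot extension $F/K$, the Picard-Vessiot ring $T(F/K)$ is the set of elements of $F$ that satisfy some non-trivial homogeneous linear differential equation with coefficients in $K$. For Picard-Vessiot extensions $F_1/K$ and $F_2/K$ with $K\subset F_1\subset F_2$, an element $\Phi\in F_2$ is an integral of second level (with respect to $K$) if $\Phi'\in T(F_1/K)$. *)

theory Defs
  imports
    "HOL-Complex_Analysis.Complex_Analysis"
    "HOL-Algebra.Bij"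
    "HOL-Algebra.Solvable_Groups"
    "Jordan_Normal_Form.Matrix"
begin

section \<open>Hamiltonian systems\<close>

definition cholomorphic_on :: "(complex ^ 'm::finite \<Rightarrow> complex) \<Rightarrow> (complex ^ 'm) set \<Rightarrow> bool" where
  "cholomorphic_on f U \<longleftrightarrow>
     (\<forall>z\<in>U. \<exists>l :: 'm \<Rightarrow> complex. (f has_derivative (\<lambda>h. \<Sum>i\<in>UNIV. l i * vec_nth h i)) (at z))"

definition pderiv_at :: "'m::finite \<Rightarrow> (complex ^ 'm \<Rightarrow> complex) \<Rightarrow> (complex ^ 'm \<Rightarrow> complex)" where
  "pderiv_at j f = (\<lambda>z. deriv (\<lambda>w. f (z + axis j w)) 0)"

text \<open>Coordinates of phase space: \<^term>\<open>Inl k\<close> is the position \<open>q\<^sub>k\<close>, \<^term>\<open>Inr k\<close> the conjugate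
  momentum \<open>p\<^sub>k\<close>.\<close>

definition hamiltonian_field ::
    "(complex ^ ('n::finite + 'n) \<Rightarrow> complex) \<Rightarrow> 'n + 'n \<Rightarrow> complex ^ ('n + 'n) \<Rightarrow> complex" where
  "hamiltonian_field H i =
     (case i of Inl k \<Rightarrow> pderiv_at (Inr k) H | Inr k \<Rightarrow> (\<lambda>z. - pderiv_at (Inl k) H z))"

definition particular_solution ::
    "('m::finite \<Rightarrow> complex ^ 'm \<Rightarrow> complex) \<Rightarrow> (complex ^ 'm) set \<Rightarrow> complex set \<Rightarrow>
     (complex \<Rightarrow> complex ^ 'm) \<Rightarrow> bool" where
  "particular_solution v U \<Omega> x0 \<longleftrightarrow>
     open \<Omega> \<and> connected \<Omega> \<and> \<Omega> \<noteq> {} \<and>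
     (\<forall>t\<in>\<Omega>. x0 t \<in> U \<and>
        (\<forall>i. ((\<lambda>s. vec_nth (x0 s) i) has_field_derivative v i (x0 t)) (at t)))"

definition pderiv_along ::
    "('m::finite \<Rightarrow> complex ^ 'm \<Rightarrow> complex) \<Rightarrow> (complex \<Rightarrow> complex ^ 'm) \<Rightarrow>
     'm list \<Rightarrow> 'm \<Rightarrow> complex \<Rightarrow> complex" where
  "pderiv_along v x0 js i = (\<lambda>t. foldr pderiv_at js (v i) (x0 t))"


section \<open>Differential fields\<close>

text \<open>Differential fields are differential subfields of one ambient differential field, the type
  \<^typ>\<open>'a\<close> with derivation \<open>D\<close>. The complex numbers enter through a field embedding \<open>\<iota>\<close>.\<close>

definition derivation :: "('a::field \<Rightarrow> 'a) \<Rightarrow> bool" where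
  "derivation D \<longleftrightarrow> (\<forall>x y. D (x + y) = D x + D y) \<and> (\<forall>x y. D (x * y) = D x * y + x * D y)"

definition constants :: "('a::field \<Rightarrow> 'a) \<Rightarrow> 'a set" where
  "constants D = {x. D x = 0}"

definition diff_subfield :: "('a::field \<Rightarrow> 'a) \<Rightarrow> 'a set \<Rightarrow> bool" where
  "diff_subfield D K \<longleftrightarrow> 1 \<in> K \<and> (\<forall>x\<in>K. \<forall>y\<in>K. x - y \<in> K \<and> x * y \<in> K) \<and>
     (\<forall>x\<in>K. inverse x \<in> K) \<and> (\<forall>x\<in>K. D x \<in> K)"

text \<open>Differential generation. All generators used below have derivatives in the field generated by
  \<open>K\<close> and the generators, so that it amounts to the plain generation of fields.\<close>

definition adjoin :: "('a::field \<Rightarrow> 'a) \<Rightarrow> 'a set \<Rightarrow> 'a set \<Rightarrow> 'a set" where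
  "adjoin D K S = \<Inter> {E. diff_subfield D E \<and> K \<union> S \<subseteq> E}"

text \<open>\<open>\<phi>\<close> identifies a differential algebra \<open>R\<close> of holomorphic functions on \<open>\<Omega>\<close> with a part of \<open>K\<close>.
  Members of \<open>R\<close> are total functions, of which only the restriction to \<open>\<Omega>\<close> matters.\<close>

definition differential_embedding ::
    "complex set \<Rightarrow> ('a::field \<Rightarrow> 'a) \<Rightarrow> (complex \<Rightarrow> 'a) \<Rightarrow> 'a set \<Rightarrow>
     (complex \<Rightarrow> complex) set \<Rightarrow> ((complex \<Rightarrow> complex) \<Rightarrow> 'a) \<Rightarrow> bool" where
  "differential_embedding \<Omega> D \<iota> K R \<phi> \<longleftrightarrow>
     (\<forall>f\<in>R. f holomorphic_on \<Omega>) \<and>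
     (\<forall>c. (\<lambda>_. c) \<in> R \<and> \<phi> (\<lambda>_. c) = \<iota> c) \<and>
     (\<forall>f\<in>R. \<forall>g\<in>R. (\<lambda>t. f t + g t) \<in> R \<and> \<phi> (\<lambda>t. f t + g t) = \<phi> f + \<phi> g) \<and>
     (\<forall>f\<in>R. \<forall>g\<in>R. (\<lambda>t. f t * g t) \<in> R \<and> \<phi> (\<lambda>t. f t * g t) = \<phi> f * \<phi> g) \<and>
     (\<forall>f\<in>R. deriv f \<in> R \<and> \<phi> (deriv f) = D (\<phi> f)) \<and>
     (\<forall>f\<in>R. \<phi> f = 0 \<longleftrightarrow> (\<forall>t\<in>\<Omega>. f t = 0)) \<and>
     \<phi> ` R \<subseteq> K"


section \<open>The chain of variational equations\<close>

text \<open>The component \<open>j\<close> of \<open>\<epsilon> x\<^sub>1 + \<epsilon>\<^sup>2 x\<^sub>2 / 2! + \<epsilon>\<^sup>3 x\<^sub>3 / 3! + \<dots>\<close>, as a power series in \<open>\<epsilon>\<close>.\<close>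

definition perturbation :: "(nat \<Rightarrow> 'm \<Rightarrow> 'a::field_char_0) \<Rightarrow> 'm \<Rightarrow> 'a fps" where
  "perturbation x j = Abs_fps (\<lambda>k. if k = 0 then 0 else x k j / fact k)"

text \<open>For \<open>q \<ge> 1\<close>, \<open>q!\<close> times the coefficient of \<open>\<epsilon>\<^sup>q\<close> in the Taylor expansion of
  \<open>v\<^sub>i (x\<^sub>0 + \<epsilon> x\<^sub>1 + \<epsilon>\<^sup>2 x\<^sub>2 / 2! + \<dots>)\<close>, where \<open>a [j\<^sub>1, \<dots>, j\<^sub>m] i\<close> is the value along \<open>x\<^sub>0\<close> of
  \<open>\<partial>\<^sub>j\<^sub>1 \<dots> \<partial>\<^sub>j\<^sub>m v\<^sub>i\<close>. The Taylor polynomial is written with ordered lists of indices, hence the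
  factor \<open>1 / m!\<close> for all of them. The term of order \<open>0\<close> is free of \<open>\<epsilon>\<close>, those of order greater than
  \<open>q\<close> are divisible by \<open>\<epsilon>\<^sup>q\<^sup>+\<^sup>1\<close>.\<close>

definition variational_rhs ::
    "('m::finite list \<Rightarrow> 'm \<Rightarrow> 'a::field_char_0) \<Rightarrow> nat \<Rightarrow> (nat \<Rightarrow> 'm \<Rightarrow> 'a) \<Rightarrow> 'm \<Rightarrow> 'a" where
  "variational_rhs a q x i =
     fact q * (\<Sum>js | js \<noteq> [] \<and> length js \<le> q.
       a js i / fact (length js) * fps_nth (\<Prod>j\<leftarrow>js. perturbation x j) q)"

text \<open>\<open>x 1, \<dots>, x p\<close> solve the system \<open>VE\<^sub>p\<close>; the other values of \<open>x\<close> are irrelevant.\<close>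

definition solves_VE ::
    "('a::field_char_0 \<Rightarrow> 'a) \<Rightarrow> ('m::finite list \<Rightarrow> 'm \<Rightarrow> 'a) \<Rightarrow> nat \<Rightarrow> (nat \<Rightarrow> 'm \<Rightarrow> 'a) \<Rightarrow> bool" where
  "solves_VE D a p x \<longleftrightarrow> (\<forall>q\<in>{1..p}. \<forall>i. D (x q i) = variational_rhs a q x i)"

lemma variational_rhs_linear_part:
  fixes a :: "'m::finite list \<Rightarrow> 'm \<Rightarrow> 'a::field_char_0"
  assumes "q \<ge> 1"
  shows "variational_rhs a q x i =
           (\<Sum>j\<in>UNIV. a [j] i * x q j) +
           fact q * (\<Sum>js | 2 \<le> length js \<and> length js \<le> q.
             a js i / fact (length js) * fps_nth (\<Prod>j\<leftarrow>js. perturbation x j) q)"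
proof -
  let ?g = "\<lambda>js. a js i / fact (length js) * fps_nth (\<Prod>j\<leftarrow>js. perturbation x j) q"
  let ?S = "{js :: 'm list. 2 \<le> length js \<and> length js \<le> q}"
  let ?L = "(\<lambda>j :: 'm. [j]) ` UNIV"
  have S: "{js :: 'm list. js \<noteq> [] \<and> length js \<le> q} = ?L \<union> ?S"
  proof (rule Set.set_eqI)
    fix js :: "'m list"
    show "js \<in> {js. js \<noteq> [] \<and> length js \<le> q} \<longleftrightarrow> js \<in> ?L \<union> ?S"
      using assms by (cases js; cases "tl js") auto
  qed
  have fin: "finite ?S"
    by (rule finite_subset[OF _ finite_lists_length_le[of UNIV q]]) auto
  have "sum ?g {js. js \<noteq> [] \<and> length js \<le> q} = sum ?g ?L + sum ?g ?S"
    unfolding S by (rule sum.union_disjoint) (use fin in auto)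
  moreover have "sum ?g ?L = (\<Sum>j\<in>UNIV. a [j] i * (x q j / fact q))"
    using assms by (subst sum.reindex) (auto simp: inj_on_def perturbation_def)
  ultimately show ?thesis
    unfolding variational_rhs_def by (simp add: distrib_left sum_distrib_left)
qed

text \<open>The ambient differential field contains all solutions of all \<open>VE\<^sub>p\<close>, that is, a family of
  solutions with the full number of free constants: \<open>VE\<^sub>1\<close> has a fundamental matrix (columns
  \<open>X k\<close>), and the next equation of the chain, linear inhomogeneous with the same homogeneous part,
  is solvable for every solution of the previous ones.\<close>

definition contains_all_solutions ::
    "('a::field_char_0 \<Rightarrow> 'a) \<Rightarrow> ('m::finite list \<Rightarrow> 'm \<Rightarrow> 'a) \<Rightarrow> bool" where
  "contains_all_solutions D a \<longleftrightarrow>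
     (\<exists>X :: 'm \<Rightarrow> 'm \<Rightarrow> 'a. (\<forall>k. solves_VE D a 1 (\<lambda>_. X k)) \<and> invertible (\<chi> i k. X k i)) \<and>
     (\<forall>p\<ge>1. \<forall>x. solves_VE D a p x \<longrightarrow> (\<exists>y. solves_VE D a (Suc p) (x(Suc p := y))))"

definition PV_VE ::
    "('a::field_char_0 \<Rightarrow> 'a) \<Rightarrow> 'a set \<Rightarrow> ('m::finite list \<Rightarrow> 'm \<Rightarrow> 'a) \<Rightarrow> nat \<Rightarrow> 'a set" where
  "PV_VE D K a p = adjoin D K {x q i | x q i. solves_VE D a p x \<and> q \<in> {1..p}}"


section \<open>Picard-Vessiot extensions\<close>

text \<open>\<open>F\<close> is generated over \<open>K\<close> by the entries of the fundamental matrix \<open>Y\<close> of a system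
  \<open>Y' = B Y\<close> with coefficients in \<open>K\<close>.\<close>

definition fundamental_matrix ::
    "('a::field \<Rightarrow> 'a) \<Rightarrow> 'a set \<Rightarrow> 'a set \<Rightarrow> nat \<Rightarrow> 'a mat \<Rightarrow> bool" where
  "fundamental_matrix D K F m Y \<longleftrightarrow>
     Y \<in> carrier_mat m m \<and> invertible_mat Y \<and>
     (\<exists>B\<in>carrier_mat m m. elements_mat B \<subseteq> K \<and> map_mat D Y = B * Y) \<and>
     F = adjoin D K (elements_mat Y)"

definition picard_vessiot :: "('a::field \<Rightarrow> 'a) \<Rightarrow> 'a set \<Rightarrow> 'a set \<Rightarrow> bool" where
  "picard_vessiot D K F \<longleftrightarrow>
     diff_subfield D K \<and> diff_subfield D F \<and> K \<subseteq> F \<and>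
     F \<inter> constants D = K \<inter> constants D \<and>
     (\<exists>m Y. fundamental_matrix D K F m Y)"

definition PV_ring :: "('a::field \<Rightarrow> 'a) \<Rightarrow> 'a set \<Rightarrow> 'a set \<Rightarrow> 'a set" where
  "PV_ring D K F =
     {y \<in> F. \<exists>m (b :: nat \<Rightarrow> 'a). (\<forall>k\<le>m. b k \<in> K) \<and> (\<exists>k\<le>m. b k \<noteq> 0) \<and>
        (\<Sum>k\<le>m. b k * (D ^^ k) y) = 0}"

definition second_level_integral ::
    "('a::field \<Rightarrow> 'a) \<Rightarrow> 'a set \<Rightarrow> 'a set \<Rightarrow> 'a set \<Rightarrow> 'a \<Rightarrow> bool" where
  "second_level_integral D K F1 F2 \<Phi> \<longleftrightarrow>
     picard_vessiot D K F1 \<and> picard_vessiot D K F2 \<and> F1 \<subseteq> F2 \<and>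
     \<Phi> \<in> F2 \<and> D \<Phi> \<in> PV_ring D K F1"

definition generated_by_second_level_integrals ::
    "('a::field \<Rightarrow> 'a) \<Rightarrow> 'a set \<Rightarrow> 'a set \<Rightarrow> 'a set \<Rightarrow> bool" where
  "generated_by_second_level_integrals D K F1 F2 \<longleftrightarrow>
     F2 = adjoin D F1 {\<Phi>. second_level_integral D K F1 F2 \<Phi>}"


section \<open>The differential Galois group\<close>

definition diff_gal :: "('a::field \<Rightarrow> 'a) \<Rightarrow> 'a set \<Rightarrow> 'a set \<Rightarrow> ('a \<Rightarrow> 'a) monoid" where
  "diff_gal D K F = (BijGroup F)\<lparr>carrier :=
     {\<sigma> \<in> Bij F. (\<forall>x\<in>F. \<forall>y\<in>F. \<sigma> (x + y) = \<sigma> x + \<sigma> y \<and> \<sigma> (x * y) = \<sigma> x * \<sigma> y) \<and>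
        (\<forall>x\<in>F. \<sigma> (D x) = D (\<sigma> x)) \<and> (\<forall>x\<in>K. \<sigma> x = x)}\<rparr>"

inductive_set polynomial_on_matrices :: "nat \<Rightarrow> (complex mat \<Rightarrow> complex) set" for m :: nat where
  const: "(\<lambda>_. c) \<in> polynomial_on_matrices m"
| entry: "i < m \<Longrightarrow> j < m \<Longrightarrow> (\<lambda>C. C $$ (i, j)) \<in> polynomial_on_matrices m"
| add: "P \<in> polynomial_on_matrices m \<Longrightarrow> Q \<in> polynomial_on_matrices m \<Longrightarrow>
          (\<lambda>C. P C + Q C) \<in> polynomial_on_matrices m"
| mult: "P \<in> polynomial_on_matrices m \<Longrightarrow> Q \<in> polynomial_on_matrices m \<Longrightarrow>
          (\<lambda>C. P C * Q C) \<in> polynomial_on_matrices m"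

text \<open>A fundamental matrix \<open>Y\<close> of a Picard-Vessiot extension represents \<open>\<sigma>\<close> faithfully by the complex
  matrix \<open>C\<close> with \<open>\<sigma> Y = Y C\<close>. The Zariski topology of the matrix group obtained in this way, pulled
  back to the Galois group, does not depend on \<open>Y\<close>, so that all fundamental matrices may contribute
  basic open sets.\<close>

definition zariski_gal ::
    "('a::field \<Rightarrow> 'a) \<Rightarrow> (complex \<Rightarrow> 'a) \<Rightarrow> 'a set \<Rightarrow> 'a set \<Rightarrow> ('a \<Rightarrow> 'a) topology" where
  "zariski_gal D \<iota> K F = topology_generated_by
     {{\<sigma> \<in> carrier (diff_gal D K F).
         \<exists>C\<in>carrier_mat m m. map_mat \<sigma> Y = Y * map_mat \<iota> C \<and> P C \<noteq> 0} | m Y P.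
       fundamental_matrix D K F m Y \<and> P \<in> polynomial_on_matrices m}"

definition identity_component ::
    "('a::field \<Rightarrow> 'a) \<Rightarrow> (complex \<Rightarrow> 'a) \<Rightarrow> 'a set \<Rightarrow> 'a set \<Rightarrow> ('a \<Rightarrow> 'a) monoid" where
  "identity_component D \<iota> K F = (diff_gal D K F)\<lparr>carrier :=
     connected_component_of_set (zariski_gal D \<iota> K F) \<one>\<^bsub>diff_gal D K F\<^esub>\<rparr>"

definition virtually_abelian_galois_group ::
    "('a::field \<Rightarrow> 'a) \<Rightarrow> (complex \<Rightarrow> 'a) \<Rightarrow> 'a set \<Rightarrow> 'a set \<Rightarrow> bool" where
  "virtually_abelian_galois_group D \<iota> K F \<longleftrightarrow> comm_group (identity_component D \<iota> K F)"

definition solvable_picard_vessiot ::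
    "('a::field \<Rightarrow> 'a) \<Rightarrow> (complex \<Rightarrow> 'a) \<Rightarrow> 'a set \<Rightarrow> 'a set \<Rightarrow> bool" where
  "solvable_picard_vessiot D \<iota> K F \<longleftrightarrow>
     picard_vessiot D K F \<and> solvable (identity_component D \<iota> K F)"

end

theory Submission
  imports Defs "Jordan_Normal_Form.Determinant"
begin

text \<open>
  The equations of the chain are nonlinear, but every one of them is linear in its own unknown:
  if \<open>X\<close> is a fundamental matrix of \<open>VE\<^sub>1\<close>, the substitution \<open>x\<^sub>p\<^sub>+\<^sub>1 = X c\<close> turns the last equation
  of \<open>VE\<^sub>p\<^sub>+\<^sub>1\<close> into \<open>c' = X\<^sup>-\<^sup>1 f\<^sub>p\<^sub>+\<^sub>1(x\<^sub>1, \<dots>, x\<^sub>p)\<close>. Everything rests on two consequences.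

  \<^emph>\<open>The fields \<open>PV(VE\<^sub>p)\<close> are Picard-Vessiot extensions.\<close> Give the unknown \<open>x\<^sub>q\<close> the weight \<open>q\<close>. Along
  solutions of \<open>VE\<^sub>p\<close> the derivative of a monomial of weight at most \<open>p\<close> is a combination, with
  coefficients in \<open>K\<close>, of monomials of weight at most \<open>p\<close>, so that the vector of all these monomials
  solves a linear system \<open>u' = B u\<close>. A polynomial that vanishes at all solutions of \<open>VE\<^sub>p\<close> is zero
  (\<open>vanishing_on_solutions\<close>), because the last unknown runs through the affine space
  \<open>y + X \<complex>\<^sup>m\<close> while the previous ones stay fixed. Together with the linear independence of
  monomials (\<open>monomials_independent\<close>) this says that the vectors of monomials, taken at all solutions,
  span the whole space; finitely many solutions therefore give a fundamental matrix with entries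
  in \<open>PV(VE\<^sub>p)\<close>, and these entries generate the field (\<open>fundamental_matrix_PV_VE\<close>).

  \<^emph>\<open>The steps of the tower are generated by integrals.\<close> The components of \<open>c\<close> together with
  \<open>PV(VE\<^sub>p)\<close> generate \<open>PV(VE\<^sub>p\<^sub>+\<^sub>1)\<close>. Their derivatives are combinations over \<open>K\<close> of the functions
  (entry of \<open>X\<^sup>-\<^sup>1\<close>) times (monomial in the \<open>x\<^sub>q\<close>), which again solve a linear system over \<open>K\<close>; hence
  they lie in the Picard-Vessiot ring, and the components of \<open>c\<close> are second level integrals
  (\<open>generated_by_second_level_integrals_PV_VE\<close>).

  For solvability let \<open>S\<close> be the identity component of the Galois group of \<open>PV(VE\<^sub>p)\<close>. Restriction of
  automorphisms to \<open>PV(VE\<^sub>1)\<close> is continuous for the Zariski topologies, so it maps \<open>S\<close> into the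
  identity component of the Galois group of \<open>VE\<^sub>1\<close>, which is Abelian: commutators of \<open>S\<close> act trivially on
  \<open>PV(VE\<^sub>1)\<close>. Two automorphisms that act trivially on \<open>PV(VE\<^sub>q)\<close> translate the integrals generating
  \<open>PV(VE\<^sub>q\<^sub>+\<^sub>1)\<close> by constants, hence commute there, and their commutator acts trivially on
  \<open>PV(VE\<^sub>q\<^sub>+\<^sub>1)\<close>. So the \<open>p\<close>-th derived group of \<open>S\<close> is trivial (\<open>solvable_PV_VE\<close>).

  The locale \<open>variational_equations\<close> fixes a chain with coefficients in \<open>K\<close> and all solutions in the
  ambient field; the Hamiltonian system enters through the coefficients of its chain.
\<close>


section \<open>Differential fields\<close>

locale differential_field =
  fixes D :: "'a::field_char_0 \<Rightarrow> 'a" and \<iota> :: "complex \<Rightarrow> 'a"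
  assumes derivation: "derivation D"
    and field_hom_iota: "field_hom \<iota>"
    and constants_eq: "constants D = range \<iota>"
begin

sublocale \<iota>: field_hom \<iota>
  by (rule field_hom_iota)

lemma D_add: "D (x + y) = D x + D y"
  using derivation by (simp add: derivation_def)

lemma D_mult: "D (x * y) = D x * y + x * D y"
  using derivation by (simp add: derivation_def)

lemma D_0 [simp]: "D 0 = 0"
  using D_add[of 0 0] by simp

lemma D_1 [simp]: "D 1 = 0"
  using D_mult[of 1 1] by simp

lemma D_minus: "D (- x) = - D x"
  using D_add[of x "- x"] by (simp add: eq_neg_iff_add_eq_0 add.commute)

lemma D_diff: "D (x - y) = D x - D y"
  using D_add[of x "- y"] by (simp add: D_minus)

lemma D_sum: "D (sum f A) = (\<Sum>i\<in>A. D (f i))"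
  by (induction A rule: infinite_finite_induct) (auto simp: D_add)

lemma D_iota [simp]: "D (\<iota> c) = 0"
  using constants_eq by (auto simp: constants_def)

lemma D_eq_0_iff: "D x = 0 \<longleftrightarrow> x \<in> range \<iota>"
  using constants_eq by (auto simp: constants_def)

lemma infinite_range_iota: "infinite (range \<iota>)"
proof
  assume "finite (range \<iota>)"
  then have "finite (UNIV :: complex set)"
    by (rule finite_imageD) (auto simp: inj_on_def)
  then show False
    using infinite_UNIV_char_0 by blast
qed

end

lemma diff_subfieldD:
  assumes "diff_subfield D K"
  shows "1 \<in> K" "x \<in> K \<Longrightarrow> y \<in> K \<Longrightarrow> x - y \<in> K" "x \<in> K \<Longrightarrow> y \<in> K \<Longrightarrow> x * y \<in> K"
    "x \<in> K \<Longrightarrow> inverse x \<in> K" "x \<in> K \<Longrightarrow> D x \<in> K"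
  using assms by (auto simp: diff_subfield_def)

lemma diff_subfield_0: "diff_subfield D K \<Longrightarrow> 0 \<in> K"
  using diff_subfieldD(1)[of D K] diff_subfieldD(2)[of D K 1 1] by simp

lemma diff_subfield_minus: "diff_subfield D K \<Longrightarrow> x \<in> K \<Longrightarrow> - x \<in> K"
  using diff_subfieldD(2)[of D K 0 x] diff_subfield_0[of D K] by simp

lemma diff_subfield_add: "diff_subfield D K \<Longrightarrow> x \<in> K \<Longrightarrow> y \<in> K \<Longrightarrow> x + y \<in> K"
  using diff_subfieldD(2)[of D K x "- y"] diff_subfield_minus[of D K y] by simp

lemma diff_subfield_sum:
  "diff_subfield D K \<Longrightarrow> (\<And>i. i \<in> A \<Longrightarrow> f i \<in> K) \<Longrightarrow> sum f A \<in> K"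
  by (induction A rule: infinite_finite_induct) (auto simp: diff_subfield_0 diff_subfield_add)

lemma diff_subfield_divide: "diff_subfield D K \<Longrightarrow> x \<in> K \<Longrightarrow> y \<in> K \<Longrightarrow> x / y \<in> K"
  by (simp add: divide_inverse diff_subfieldD)

lemma diff_subfield_of_nat: "diff_subfield D K \<Longrightarrow> of_nat n \<in> K"
  by (induction n) (auto simp: diff_subfield_0 diff_subfield_add diff_subfieldD)

lemma diff_subfield_fact: "diff_subfield D K \<Longrightarrow> fact n \<in> K"
  using diff_subfield_of_nat[of D K "fact n"] by simp

lemmas diff_subfield_closed =
  diff_subfieldD diff_subfield_0 diff_subfield_minus diff_subfield_add diff_subfield_divide

lemma diff_subfield_adjoin: "diff_subfield D (adjoin D K S)"
  by (auto simp: adjoin_def diff_subfield_def)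

lemma adjoin_superset: "K \<subseteq> adjoin D K S" "S \<subseteq> adjoin D K S"
  by (auto simp: adjoin_def)

lemma adjoin_least:
  "diff_subfield D E \<Longrightarrow> K \<subseteq> E \<Longrightarrow> S \<subseteq> E \<Longrightarrow> adjoin D K S \<subseteq> E"
  by (auto simp: adjoin_def)


section \<open>Polynomials in the unknowns of the variational equations\<close>

text \<open>Polynomials over \<open>K\<close> in the unknowns \<open>x\<^sub>1, \<dots>, x\<^sub>w\<close>, of weight at most \<open>w\<close> when \<open>x\<^sub>k\<close> has weight \<open>k\<close>. They are
  represented as functions on a space of points with coordinates in the whole ambient field, so that the
  derivation and the substitution of solutions can be applied to them directly.\<close>

inductive wpoly :: "'a::field set \<Rightarrow> nat \<Rightarrow> ((nat \<Rightarrow> 'm \<Rightarrow> 'a) \<Rightarrow> 'a) \<Rightarrow> bool"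
  for K :: "'a set" where
  const: "c \<in> K \<Longrightarrow> wpoly K w (\<lambda>_. c)"
| var: "1 \<le> k \<Longrightarrow> k \<le> w \<Longrightarrow> wpoly K w (\<lambda>x. x k j)"
| add: "wpoly K w P \<Longrightarrow> wpoly K w Q \<Longrightarrow> wpoly K w (\<lambda>x. P x + Q x)"
| mult: "wpoly K u P \<Longrightarrow> wpoly K v Q \<Longrightarrow> u + v \<le> w \<Longrightarrow> wpoly K w (\<lambda>x. P x * Q x)"

lemma wpoly_mono: "wpoly K u P \<Longrightarrow> u \<le> w \<Longrightarrow> wpoly K w P"
proof (induction arbitrary: w rule: wpoly.induct)
  case (mult u P v Q w')
  show ?case
    by (rule wpoly.mult[OF mult.hyps(1,2)]) (use mult in auto)
qed (auto intro: wpoly.intros)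

lemma wpoly_scale: "c \<in> K \<Longrightarrow> wpoly K w P \<Longrightarrow> wpoly K w (\<lambda>x. c * P x)"
  by (rule wpoly.mult[of K 0 "\<lambda>_. c" w P]) (auto intro: wpoly.const)

lemma wpoly_sum:
  "0 \<in> K \<Longrightarrow> (\<And>i. i \<in> A \<Longrightarrow> wpoly K w (P i)) \<Longrightarrow> wpoly K w (\<lambda>x. \<Sum>i\<in>A. P i x)"
  by (induction A rule: infinite_finite_induct) (auto intro: wpoly.intros)

lemma wpoly_value:
  assumes "wpoly K w P" "diff_subfield D F" "K \<subseteq> F" "\<And>k j. 1 \<le> k \<Longrightarrow> k \<le> w \<Longrightarrow> x k j \<in> F"
  shows "P x \<in> F"
  using assms(1,4)
proof (induction rule: wpoly.induct)
  case (const c w)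
  then show ?case using assms(3) by auto
qed (auto intro: diff_subfield_closed[OF assms(2)])

lemma perturbation_wpoly:
  fixes K :: "'a::field_char_0 set"
  assumes "diff_subfield D K"
  shows "wpoly K n (\<lambda>x. fps_nth (perturbation x j) n)"
proof (cases "n = 0")
  case True
  then show ?thesis
    by (auto simp: perturbation_def intro!: wpoly.const diff_subfield_0 assms)
next
  case False
  have "wpoly K n (\<lambda>x. inverse (fact n) * x n j)"
    by (rule wpoly_scale) (use False in \<open>auto intro: wpoly.var diff_subfield_closed[OF assms] diff_subfield_fact[OF assms]\<close>)
  then show ?thesis
    using False by (simp add: perturbation_def field_simps)
qed

text \<open>The weights are made for this: the unknown \<open>x\<^sub>k\<close> accompanies \<open>\<epsilon>\<^sup>k\<close>, so the coefficient of \<open>\<epsilon>\<^sup>n\<close> has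
  weight \<open>n\<close>.\<close>

lemma perturbation_prod_wpoly:
  fixes K :: "'a::field_char_0 set"
  assumes "diff_subfield D K"
  shows "wpoly K n (\<lambda>x. fps_nth (\<Prod>j\<leftarrow>js. perturbation x j) n)"
proof (induction js arbitrary: n)
  case Nil
  show ?case
    by (auto simp: fps_one_nth intro!: wpoly.const diff_subfield_closed[OF assms])
next
  case (Cons j js)
  have "wpoly K n (\<lambda>x. \<Sum>i=0..n. fps_nth (perturbation x j) i *
          fps_nth (\<Prod>j\<leftarrow>js. perturbation x j) (n - i))"
    by (intro wpoly_sum diff_subfield_0[OF assms] 
        wpoly.mult[OF perturbation_wpoly[OF assms] Cons.IH])
       auto
  then show ?case
    by (simp add: fps_mult_nth)
qed

lemma variational_rhs_wpoly:
  fixes K :: "'a::field_char_0 set"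
  assumes "diff_subfield D K" "\<And>js i. js \<noteq> [] \<Longrightarrow> a js i \<in> K"
  shows "wpoly K q (\<lambda>x. variational_rhs a q x i)"
  unfolding variational_rhs_def
  by (intro wpoly_scale wpoly_sum perturbation_prod_wpoly[OF assms(1)]
      diff_subfield_closed[OF assms(1)] diff_subfield_fact[OF assms(1)])
     (auto intro!: diff_subfield_closed[OF assms(1)] diff_subfield_fact[OF assms(1)] assms(2))

definition monomial :: "(nat \<times> 'm) multiset \<Rightarrow> (nat \<Rightarrow> 'm \<Rightarrow> 'a::comm_monoid_mult) \<Rightarrow> 'a" where
  "monomial M x = (\<Prod>(k, j)\<in>#M. x k j)"

text \<open>The weight of a multiset of variables is bounded, rather than prescribed, in order to have one finite
  family that contains the unknowns \<open>x\<^sub>1, \<dots>, x\<^sub>w\<close> themselves.\<close>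

definition monomials :: "nat \<Rightarrow> (nat \<times> 'm) multiset set" where
  "monomials w = {M. (\<forall>v\<in>#M. 1 \<le> fst v) \<and> (\<Sum>v\<in>#M. fst v) \<le> w}"

lemma size_le_weight: "(\<forall>v\<in>#M. 1 \<le> fst v) \<Longrightarrow> size M \<le> (\<Sum>v\<in>#M. fst v)"
  for M :: "(nat \<times> 'm) multiset"
  by (induction M) auto

lemma monomials_bounds:
  assumes "M \<in> monomials w"
  shows "size M \<le> w" "v \<in># M \<Longrightarrow> fst v \<in> {1..w}"
proof -
  show "size M \<le> w"
    using assms size_le_weight[of M] by (auto simp: monomials_def)
  show "fst v \<in> {1..w}" if "v \<in># M"
  proof -
    have "fst v \<le> (\<Sum>v\<in>#M. fst v)"
      using that by (metis insert_DiffM le_add1 sum_mset.insert image_mset_add_mset)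
    then show ?thesis
      using assms that by (auto simp: monomials_def)
  qed
qed

text \<open>All weights are positive, so a monomial of weight at most \<open>w\<close> has at most \<open>w\<close> factors.\<close>

lemma finite_monomials: "finite (monomials w :: (nat \<times> 'm::finite) multiset set)"
proof -
  have "(monomials w :: (nat \<times> 'm) multiset set)
          \<subseteq> mset ` {xs. set xs \<subseteq> {1..w} \<times> UNIV \<and> length xs \<le> w}"
  proof
    fix M :: "(nat \<times> 'm) multiset" assume M: "M \<in> monomials w"
    obtain xs where xs: "M = mset xs"
      using ex_mset by metis
    have "set xs \<subseteq> {1..w} \<times> UNIV"
    proof
      fix v assume "v \<in> set xs"
      then show "v \<in> {1..w} \<times> UNIV"
        using monomials_bounds(2)[OF M, of v] xs by (simp add: mem_Times_iff)
    qed
    moreover have "length xs \<le> w"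
      using monomials_bounds(1)[OF M] xs by simp
    ultimately show "M \<in> mset ` {xs. set xs \<subseteq> {1..w} \<times> UNIV \<and> length xs \<le> w}"
      using xs by blast
  qed
  then show ?thesis
    by (rule finite_subset) (intro finite_imageI finite_lists_length_le; simp)
qed

lemma monomial_union: "monomial (M + N) x = monomial M x * monomial N x"
  by (simp add: monomial_def)

lemma monomials_union:
  "M \<in> monomials u \<Longrightarrow> N \<in> monomials v \<Longrightarrow> u + v \<le> w \<Longrightarrow> M + N \<in> monomials w"
  by (auto simp: monomials_def)

lemma monomial_wpoly: "M \<in> monomials w \<Longrightarrow> 1 \<in> K \<Longrightarrow> wpoly K w (monomial M)"
proof (induction M arbitrary: w)
  case empty
  then show ?case
    by (auto simp: monomial_def[abs_def] intro: wpoly.const)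
next
  case (add v M)
  obtain k j where v: "v = (k, j)" by force
  have M: "M \<in> monomials (w - k)" and k: "1 \<le> k" "k \<le> w"
    using add.prems v by (auto simp: monomials_def)
  have "wpoly K w (\<lambda>x. x k j * monomial M x)"
    by (rule wpoly.mult[OF wpoly.var[OF k(1) order_refl] add.IH[OF M]]) (use k add in auto)
  then show ?case
    by (simp add: monomial_def v)
qed

definition monomial_span :: "'a::field set \<Rightarrow> nat \<Rightarrow> ((nat \<Rightarrow> 'm::finite \<Rightarrow> 'a) \<Rightarrow> 'a) set" where
  "monomial_span K w =
     {P. \<exists>c. (\<forall>M. c M \<in> K) \<and> (\<forall>x. P x = (\<Sum>M\<in>monomials w. c M * monomial M x))}"

lemma monomial_spanI:
  assumes "diff_subfield D K" "c \<in> K" "M \<in> monomials w" "\<And>x. P x = c * monomial M x"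
  shows "P \<in> monomial_span K w"
proof -
  have "P x = (\<Sum>N\<in>monomials w. (if N = M then c else 0) * monomial N x)" for x
    using assms(3,4) finite_monomials by (subst sum.remove[of _ M]) auto
  then show ?thesis
    unfolding monomial_span_def
    by (auto intro!: exI[of _ "\<lambda>N. if N = M then c else 0"] simp: assms diff_subfield_0[OF assms(1)])
qed

lemma monomial_span_add:
  assumes "diff_subfield D K" "P \<in> monomial_span K w" "Q \<in> monomial_span K w"
  shows "(\<lambda>x. P x + Q x) \<in> monomial_span K w"
proof -
  obtain c d where "\<forall>M. c M \<in> K" "\<forall>M. d M \<in> K"
    "\<forall>x. P x = (\<Sum>M\<in>monomials w. c M * monomial M x)"
    "\<forall>x. Q x = (\<Sum>M\<in>monomials w. d M * monomial M x)"
    using assms by (auto simp: monomial_span_def)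
  then show ?thesis
    unfolding monomial_span_def
    by (auto intro!: exI[of _ "\<lambda>M. c M + d M"] diff_subfield_add[OF assms(1)]
        simp: sum.distrib algebra_simps)
qed

lemma monomial_span_sum:
  assumes "diff_subfield D K" "\<And>i. i \<in> A \<Longrightarrow> P i \<in> monomial_span K w"
  shows "(\<lambda>x. \<Sum>i\<in>A. P i x) \<in> monomial_span K w"
  using assms(2)
proof (induction A rule: infinite_finite_induct)
  case (insert i A)
  then show ?case
    by (auto intro!: monomial_span_add[OF assms(1)])
qed (auto simp: monomial_span_def intro!: exI[of _ "\<lambda>_. 0"] diff_subfield_0[OF assms(1)])

lemma wpoly_monomial_span:
  assumes "wpoly K w P" "diff_subfield D K"
  shows "P \<in> monomial_span K w"
  using assms(1)
proof (induction rule: wpoly.induct)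
  case (const c w)
  then show ?case
    by (intro monomial_spanI[OF assms(2), of c "{#}"]) (auto simp: monomials_def monomial_def)
next
  case (var k w j)
  then show ?case
    by (intro monomial_spanI[OF assms(2), of 1 "{#(k, j)#}"])
       (auto simp: monomials_def monomial_def diff_subfieldD[OF assms(2)])
next
  case (add P w Q)
  then show ?case
    by (intro monomial_span_add[OF assms(2)])
next
  case (mult u P v Q w)
  obtain c d where c: "\<forall>M. c M \<in> K" and d: "\<forall>M. d M \<in> K"
    and P: "\<forall>x. P x = (\<Sum>M\<in>monomials u. c M * monomial M x)"
    and Q: "\<forall>x. Q x = (\<Sum>M\<in>monomials v. d M * monomial M x)"
    using mult.IH by (auto simp: monomial_span_def)
  have "(\<lambda>x. \<Sum>M\<in>monomials u. \<Sum>N\<in>monomials v. c M * d N * monomial (M + N) x)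
          \<in> monomial_span K w"
    by (intro monomial_span_sum[OF assms(2)] monomial_spanI[OF assms(2) _ monomials_union])
       (use c d mult.hyps(3) in \<open>auto intro: diff_subfieldD[OF assms(2)]\<close>)
  moreover have "P x * Q x = (\<Sum>M\<in>monomials u. \<Sum>N\<in>monomials v. c M * d N * monomial (M + N) x)" for x
    unfolding P[rule_format] Q[rule_format]
    by (simp add: sum_product monomial_union algebra_simps)
  ultimately show ?case
    by simp
qed


subsection \<open>Vanishing of polynomial functions\<close>

inductive polyfun :: "(('k \<Rightarrow> 'a::field) \<Rightarrow> 'a) \<Rightarrow> bool" where
  const: "polyfun (\<lambda>_. c)"
| var: "polyfun (\<lambda>x. x k)"
| add: "polyfun P \<Longrightarrow> polyfun Q \<Longrightarrow> polyfun (\<lambda>x. P x + Q x)"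
| mult: "polyfun P \<Longrightarrow> polyfun Q \<Longrightarrow> polyfun (\<lambda>x. P x * Q x)"

lemma polyfun_sum: "(\<And>i. i \<in> A \<Longrightarrow> polyfun (P i)) \<Longrightarrow> polyfun (\<lambda>x. \<Sum>i\<in>A. P i x)"
  by (induction A rule: infinite_finite_induct) (auto intro: polyfun.intros)

lemma polyfun_in_one_variable: "polyfun P \<Longrightarrow> \<exists>p. \<forall>t. P (x(k := t)) = poly p t"
proof (induction rule: polyfun.induct)
  case (const c)
  show ?case by (intro exI[of _ "[:c:]"]) auto
next
  case (var j)
  show ?case
    by (cases "j = k") (auto intro: exI[of _ "[:0, 1:]"] exI[of _ "[:x j:]"])
next
  case (add P Q)
  then obtain p q where "\<forall>t. P (x(k := t)) = poly p t" "\<forall>t. Q (x(k := t)) = poly q t"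
    by blast
  then have "\<forall>t. P (x(k := t)) + Q (x(k := t)) = poly (p + q) t"
    by (auto simp only: poly_add)
  then show ?case by blast
next
  case (mult P Q)
  then obtain p q where "\<forall>t. P (x(k := t)) = poly p t" "\<forall>t. Q (x(k := t)) = poly q t"
    by blast
  then have "\<forall>t. P (x(k := t)) * Q (x(k := t)) = poly (p * q) t"
    by (auto simp only: poly_mult)
  then show ?case by blast
qed

text \<open>The coordinates are released from \<open>C\<close> one after the other: in each of them the function is a polynomial
  in one variable with infinitely many zeros.\<close>

lemma polyfun_vanishing:
  fixes P :: "('k::finite \<Rightarrow> 'a::field) \<Rightarrow> 'a"
  assumes "polyfun P" "infinite C" "\<And>x. (\<forall>k. x k \<in> C) \<Longrightarrow> P x = 0"
  shows "P x = 0"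
proof -
  have "\<forall>x. (\<forall>k. k \<notin> S \<longrightarrow> x k \<in> C) \<longrightarrow> P x = 0" if "finite S" for S :: "'k set"
    using that
  proof induction
    case empty
    then show ?case using assms(3) by auto
  next
    case (insert k S)
    show ?case
    proof (intro allI impI)
      fix x :: "'k \<Rightarrow> 'a" assume x: "\<forall>j. j \<notin> insert k S \<longrightarrow> x j \<in> C"
      obtain p where p: "\<forall>t. P (x(k := t)) = poly p t"
        using polyfun_in_one_variable[OF assms(1)] by blast
      have "P (x(k := t)) = 0" if "t \<in> C" for t
        using x that by (intro insert.IH[rule_format]) auto
      then have "C \<subseteq> {t. poly p t = 0}"
        unfolding p[rule_format] by blast
      then have "p = 0"
        using assms(2) poly_roots_finite finite_subset by blast
      then show "P x = 0"
        using p[rule_format, of "x k"] by simp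
    qed
  qed
  from this[of UNIV] show ?thesis by simp
qed

text \<open>What becomes of a polynomial when all unknowns are fixed except \<open>x\<^sub>q\<close>, which varies in an affine space
  with direction \<open>X\<close> and coordinates \<open>c\<close>.\<close>

lemma polyfun_affine_substitution:
  fixes P :: "(nat \<Rightarrow> 'm \<Rightarrow> 'a::field) \<Rightarrow> 'a" and X :: "'k::finite \<Rightarrow> 'm \<Rightarrow> 'a"
  assumes "wpoly K w P"
  shows "polyfun (\<lambda>c. P (x(q := \<lambda>i. y i + (\<Sum>k\<in>UNIV. X k i * c k))))"
  using assms
proof (induction rule: wpoly.induct)
  case (var k w j)
  show ?case
    by (cases "k = q") (auto intro!: polyfun.intros polyfun_sum)
qed (auto intro: polyfun.intros)

lemma digits_unique:
  fixes f g :: "nat \<Rightarrow> nat"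
  assumes "\<And>i. f i < B" "\<And>i. g i < B" "(\<Sum>i<n. f i * B ^ i) = (\<Sum>i<n. g i * B ^ i)" "i < n"
  shows "f i = g i"
  using assms
proof (induction n arbitrary: f g i)
  case (Suc n)
  have expand: "(\<Sum>i<Suc n. h i * B ^ i) = h 0 + B * (\<Sum>i<n. h (Suc i) * B ^ i)" for h :: "nat \<Rightarrow> nat"
    by (subst sum.lessThan_Suc_shift) (simp add: sum_distrib_left algebra_simps)
  have B: "B > 0"
    using Suc.prems(1)[of 0] by linarith
  have eq: "f 0 + B * (\<Sum>i<n. f (Suc i) * B ^ i) = g 0 + B * (\<Sum>i<n. g (Suc i) * B ^ i)"
    using Suc.prems(3) unfolding expand .
  have "f 0 = (f 0 + B * (\<Sum>i<n. f (Suc i) * B ^ i)) mod B"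
    using Suc.prems(1)[of 0] by simp
  also have "\<dots> = g 0"
    unfolding eq using Suc.prems(2)[of 0] by simp
  finally have f0: "f 0 = g 0" .
  then have tail: "(\<Sum>i<n. f (Suc i) * B ^ i) = (\<Sum>i<n. g (Suc i) * B ^ i)"
    using eq B by simp
  show ?case
  proof (cases i)
    case 0
    then show ?thesis using f0 by simp
  next
    case (Suc j)
    then show ?thesis
      using Suc.IH[of "\<lambda>i. f (Suc i)" "\<lambda>i. g (Suc i)" j] Suc.prems tail by simp
  qed
qed simp

lemma sum_mset_eq_sum_count:
  fixes d :: "'b \<Rightarrow> nat"
  assumes "finite V" "set_mset M \<subseteq> V"
  shows "(\<Sum>v\<in>#M. d v) = (\<Sum>v\<in>V. count M v * d v)"
  using assms(2)
proof (induction M)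
  case (add u M)
  have "(\<Sum>v\<in>V. count (add_mset u M) v * d v) = (\<Sum>v\<in>V. (if v = u then d v else 0) + count M v * d v)"
    by (rule sum.cong) auto
  also have "\<dots> = d u + (\<Sum>v\<in>V. count M v * d v)"
    using add.prems assms(1) by (simp add: sum.distrib)
  finally show ?case
    using add by simp
qed simp

text \<open>Kronecker substitution: enumerate the variables by \<open>e\<close> and replace the variable \<open>v\<close> by \<open>t ^ (B ^ e v)\<close>
  with \<open>B = w + 1\<close>. Exponents in the monomials are less than \<open>B\<close>, so they are the digits in base \<open>B\<close> of the
  exponent of \<open>t\<close>. Different monomials thus become different powers of \<open>t\<close>, and a relation between them
  becomes a polynomial in \<open>t\<close> that vanishes everywhere.\<close>

lemma monomials_independent:
  fixes c :: "(nat \<times> 'm::finite) multiset \<Rightarrow> 'a::field_char_0"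
  assumes zero: "\<And>x. (\<Sum>M\<in>monomials w. c M * monomial M x) = 0" and M: "M \<in> monomials w"
  shows "c M = 0"
proof -
  let ?V = "{1..w} \<times> (UNIV :: 'm set)"
  obtain e where e: "bij_betw e ?V {0..<card ?V}"
    using ex_bij_betw_finite_nat[of ?V] by auto
  define n where "n = card ?V"
  define d where "d v = Suc w ^ e v" for v
  define E where "E M = (\<Sum>v\<in>#M. d v)" for M
  let ?x = "\<lambda>t k j. t ^ d (k, j) :: 'a"
  have mon: "monomial M (?x t) = t ^ E M" for M t
    unfolding monomial_def E_def
    by (induction M) (auto simp: power_add)
  have E_digits: "E M = (\<Sum>i<n. count M (inv_into ?V e i) * Suc w ^ i)" if "M \<in> monomials w" for M
  proof -
    have sub: "set_mset M \<subseteq> ?V"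
      using monomials_bounds(2)[OF that] by (auto simp: mem_Times_iff)
    have "E M = (\<Sum>v\<in>?V. count M v * d v)"
      unfolding E_def by (rule sum_mset_eq_sum_count) (use sub in auto)
    also have "\<dots> = (\<Sum>v\<in>?V. count M (inv_into ?V e (e v)) * Suc w ^ e v)"
      using e by (intro sum.cong) (auto simp: d_def bij_betw_def)
    also have "\<dots> = (\<Sum>i\<in>{0..<n}. count M (inv_into ?V e i) * Suc w ^ i)"
      unfolding n_def by (rule sum.reindex_bij_betw[OF e])
    finally show ?thesis by (simp add: atLeast0LessThan)
  qed
  have inj: "M = N" if MN: "M \<in> monomials w" "N \<in> monomials w" "E M = E N" for M N
  proof (rule multiset_eqI)
    fix v
    have small: "count L u < Suc w" if "L \<in> monomials w" for L u
      using monomials_bounds(1)[OF that] count_le_size[of L u] by linarith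
    show "count M v = count N v"
    proof (cases "v \<in> ?V")
      case True
      then have "e v < n"
        using e by (auto simp: bij_betw_def n_def)
      then have "count M (inv_into ?V e (e v)) = count N (inv_into ?V e (e v))"
        by (rule digits_unique[rotated 3, where B = "Suc w"])
           (simp_all add: E_digits[symmetric] MN small del: One_nat_def mult_Suc power_Suc)
      then show ?thesis
        using e True by (auto simp: bij_betw_def)
    next
      case False
      then show ?thesis
        using monomials_bounds(2)[OF MN(1), of v] monomials_bounds(2)[OF MN(2), of v]
        by (metis UNIV_I count_inI mem_Times_iff)
    qed
  qed
  define p where "p = (\<Sum>M\<in>monomials w. monom (c M) (E M))"
  have "poly p t = 0" for t
    using zero[of "?x t"] by (simp add: p_def poly_sum poly_monom mon)
  then have "p = 0"
    using poly_all_0_iff_0 by blast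
  then have "0 = coeff p (E M)"
    by simp
  also have "\<dots> = (\<Sum>N\<in>monomials w. if N = M then c M else 0)"
    unfolding p_def coeff_sum by (rule sum.cong) (use inj M in auto)
  also have "\<dots> = c M"
    using M by (subst sum.delta[OF finite_monomials]) simp
  finally show ?thesis by simp
qed

section \<open>The solutions of the variational equations\<close>

lemma perturbation_prod_cong:
  assumes "\<And>k j. k \<le> n \<Longrightarrow> x k j = y k j"
  shows "fps_nth (\<Prod>j\<leftarrow>js. perturbation x j) n = fps_nth (\<Prod>j\<leftarrow>js. perturbation y j) n"
  using assms
proof (induction js arbitrary: n)
  case (Cons j js)
  have "fps_nth (perturbation x j) i * fps_nth (\<Prod>j\<leftarrow>js. perturbation x j) (n - i) =
        fps_nth (perturbation y j) i * fps_nth (\<Prod>j\<leftarrow>js. perturbation y j) (n - i)" if "i \<le> n" for i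
    using Cons.IH[of "n - i"] Cons.prems that by (simp add: perturbation_def)
  then show ?case
    by (simp add: fps_mult_nth)
qed simp

lemma perturbation_prod_nth_0:
  "js \<noteq> [] \<Longrightarrow> fps_nth (\<Prod>j\<leftarrow>js. perturbation x j) 0 = 0"
  by (cases js) (auto simp: perturbation_def)

text \<open>The perturbation starts with \<open>\<epsilon>\<close>. In the coefficient of \<open>\<epsilon>\<^sup>n\<close> in a product of two or more of them the
  unknown \<open>x\<^sub>n\<close> would have to meet a term free of \<open>\<epsilon>\<close>, so it does not occur.\<close>

lemma perturbation_prod_cong_strict:
  assumes "\<And>k j. k < n \<Longrightarrow> x k j = y k j" "2 \<le> length js"
  shows "fps_nth (\<Prod>j\<leftarrow>js. perturbation x j) n = fps_nth (\<Prod>j\<leftarrow>js. perturbation y j) n"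
proof -
  obtain j js' where js: "js = j # js'" "js' \<noteq> []"
    using assms(2) by (cases js; cases "tl js") auto
  have "fps_nth (perturbation x j) i * fps_nth (\<Prod>j\<leftarrow>js'. perturbation x j) (n - i) =
        fps_nth (perturbation y j) i * fps_nth (\<Prod>j\<leftarrow>js'. perturbation y j) (n - i)" if i: "i \<le> n" for i
  proof -
    consider "i = 0" | "i = n" | "0 < i" "i < n"
      using i by linarith
    then show ?thesis
    proof cases
      case 1
      then show ?thesis by (simp add: perturbation_def)
    next
      case 2
      then show ?thesis by (simp add: perturbation_prod_nth_0[OF js(2)])
    next
      case 3
      have "fps_nth (\<Prod>j\<leftarrow>js'. perturbation x j) (n - i) = fps_nth (\<Prod>j\<leftarrow>js'. perturbation y j) (n - i)"
        by (rule perturbation_prod_cong) (use 3 assms(1) in auto)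
      then show ?thesis
        using 3 assms(1) by (simp add: perturbation_def)
    qed
  qed
  then show ?thesis
    by (simp add: js fps_mult_nth)
qed

lemma variational_rhs_cong:
  assumes "\<And>k j. k \<le> q \<Longrightarrow> x k j = y k j"
  shows "variational_rhs a q x i = variational_rhs a q y i"
  unfolding variational_rhs_def using perturbation_prod_cong[of q x y, OF assms] by simp

text \<open>The inhomogeneous term \<open>f\<^sub>q(x\<^sub>1, \<dots>, x\<^sub>q\<^sub>-\<^sub>1)\<close> of the chain.\<close>

definition forcing ::
    "('m::finite list \<Rightarrow> 'm \<Rightarrow> 'a::field_char_0) \<Rightarrow> nat \<Rightarrow> (nat \<Rightarrow> 'm \<Rightarrow> 'a) \<Rightarrow> 'm \<Rightarrow> 'a" where
  "forcing a q x i = fact q * (\<Sum>js | 2 \<le> length js \<and> length js \<le> q.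
     a js i / fact (length js) * fps_nth (\<Prod>j\<leftarrow>js. perturbation x j) q)"

lemma variational_rhs_eq:
  "q \<ge> 1 \<Longrightarrow> variational_rhs a q x i = (\<Sum>j\<in>UNIV. a [j] i * x q j) + forcing a q x i"
  unfolding forcing_def by (rule variational_rhs_linear_part)

lemma forcing_cong:
  assumes "\<And>k j. k < q \<Longrightarrow> x k j = y k j"
  shows "forcing a q x i = forcing a q y i"
  unfolding forcing_def
  using perturbation_prod_cong_strict[of q x y, OF assms] by (auto intro!: sum.cong)

lemma forcing_1 [simp]:
  fixes a :: "'m::finite list \<Rightarrow> 'm \<Rightarrow> 'a::field_char_0"
  shows "forcing a (Suc 0) x i = 0"
proof -
  have "{js. 2 \<le> length js \<and> length js \<le> Suc 0} = ({} :: 'm list set)"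
    by auto
  then show ?thesis
    unfolding forcing_def by (simp only:) simp
qed

lemma forcing_wpoly:
  fixes K :: "'a::field_char_0 set"
  assumes "diff_subfield D K" "\<And>js i. js \<noteq> [] \<Longrightarrow> a js i \<in> K"
  shows "wpoly K q (\<lambda>x. forcing a q x i)"
  unfolding forcing_def
  by (intro wpoly_scale wpoly_sum perturbation_prod_wpoly[OF assms(1)]
      diff_subfield_closed[OF assms(1)] diff_subfield_fact[OF assms(1)])
     (auto intro!: diff_subfield_closed[OF assms(1)] diff_subfield_fact[OF assms(1)] assms(2))

lemma forcing_value:
  assumes "diff_subfield D K" "\<And>js i. js \<noteq> [] \<Longrightarrow> a js i \<in> K"
    "diff_subfield D F" "K \<subseteq> F" "\<And>k j. 1 \<le> k \<Longrightarrow> k < q \<Longrightarrow> x k j \<in> F"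
  shows "forcing a q x i \<in> F"
proof -
  let ?y = "\<lambda>k j. if k < q then x k j else 0"
  have "forcing a q x i = forcing a q ?y i"
    by (rule forcing_cong) simp
  also have "\<dots> \<in> F"
    by (rule wpoly_value[OF forcing_wpoly[OF assms(1,2)] assms(3,4)])
       (use assms(5) in \<open>auto simp: diff_subfield_0[OF assms(3)]\<close>)
  finally show ?thesis .
qed

text \<open>The range of \<open>k\<close> starts at \<open>1\<close> because a perturbation has no constant term.\<close>

lemma solves_VE_cong:
  fixes x y :: "nat \<Rightarrow> 'm::finite \<Rightarrow> 'a::field_char_0"
  assumes "\<And>k j. 1 \<le> k \<Longrightarrow> k \<le> p \<Longrightarrow> x k j = y k j"
  shows "solves_VE D a p x \<longleftrightarrow> solves_VE D a p y"
proof -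
  have pert: "perturbation x = perturbation (x(0 := y 0))" for x y :: "nat \<Rightarrow> 'm \<Rightarrow> 'a"
    by (auto simp: perturbation_def fun_eq_iff fps_eq_iff)
  have rhs: "variational_rhs a q x i = variational_rhs a q y i" if "q \<le> p" for q i
  proof -
    have "variational_rhs a q x i = variational_rhs a q (x(0 := y 0)) i"
      unfolding variational_rhs_def pert[of x y, symmetric] ..
    also have "\<dots> = variational_rhs a q y i"
      by (rule variational_rhs_cong) (use assms that in auto)
    finally show ?thesis .
  qed
  show ?thesis
    unfolding solves_VE_def using assms rhs by auto
qed

lemma solves_VE_mono: "solves_VE D a p x \<Longrightarrow> q \<le> p \<Longrightarrow> solves_VE D a q x"
  by (auto simp: solves_VE_def)

lemma solves_VE_Suc:
  "solves_VE D a (Suc p) x \<longleftrightarrow> solves_VE D a p x \<and>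
     (\<forall>i. D (x (Suc p) i) = (\<Sum>j\<in>UNIV. a [j] i * x (Suc p) j) + forcing a (Suc p) x i)"
proof -
  have "{1..Suc p} = insert (Suc p) {1..p}"
    by auto
  then show ?thesis
    by (auto simp: solves_VE_def variational_rhs_eq)
qed

text \<open>A chain of variational equations with coefficients in \<open>K\<close>; only partial derivatives of positive order
  are coefficients, hence the condition on \<open>js\<close>.\<close>

locale variational_equations = differential_field D \<iota>
  for D :: "'a::field_char_0 \<Rightarrow> 'a" and \<iota> :: "complex \<Rightarrow> 'a" +
  fixes K :: "'a set" and a :: "'m::finite list \<Rightarrow> 'm \<Rightarrow> 'a"
  assumes K: "diff_subfield D K" and range_iota: "range \<iota> \<subseteq> K"
    and coeffs: "js \<noteq> [] \<Longrightarrow> a js i \<in> K"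
    and all_solutions: "contains_all_solutions D a"
begin

lemma iota_in_K: "\<iota> c \<in> K"
  using range_iota by blast

text \<open>A fundamental matrix of \<open>VE\<^sub>1\<close>, with columns \<open>X k\<close>, and its inverse \<open>Z\<close>.\<close>

definition X :: "'m \<Rightarrow> 'm \<Rightarrow> 'a" where
  "X = (SOME X. (\<forall>k. solves_VE D a 1 (\<lambda>_. X k)) \<and> invertible (\<chi> i k. X k i))"

lemma X_solves: "solves_VE D a 1 (\<lambda>_. X k)"
  and X_invertible: "invertible (\<chi> i k. X k i)"
proof -
  have "\<exists>X :: 'm \<Rightarrow> 'm \<Rightarrow> 'a. (\<forall>k. solves_VE D a 1 (\<lambda>_. X k)) \<and> invertible (\<chi> i k. X k i)"
    using all_solutions unfolding contains_all_solutions_def by (rule conjunct1)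
  then have "(\<forall>k. solves_VE D a 1 (\<lambda>_. X k)) \<and> invertible (\<chi> i k. X k i)"
    unfolding X_def by (rule someI_ex)
  note X = this
  show "solves_VE D a 1 (\<lambda>_. X k)"
    by (rule X[THEN conjunct1, THEN spec])
  show "invertible (\<chi> i k. X k i)"
    by (rule X[THEN conjunct2])
qed

lemma D_X: "D (X k i) = (\<Sum>j\<in>UNIV. a [j] i * X k j)"
  using X_solves[of k] solves_VE_Suc[of D a 0 "\<lambda>_. X k"] by simp

definition Z :: "'m \<Rightarrow> 'm \<Rightarrow> 'a" where
  "Z k i = matrix_inv (\<chi> i k. X k i) $ k $ i"

lemma Z_X: "(\<Sum>i\<in>UNIV. Z k i * X l i) = (if k = l then 1 else 0)"
  and X_Z: "(\<Sum>k\<in>UNIV. X k i * Z k j) = (if i = j then 1 else 0)"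
proof -
  let ?X = "\<chi> i k. X k i"
  have inv: "matrix_inv ?X ** ?X = Finite_Cartesian_Product.mat 1"
    "?X ** matrix_inv ?X = Finite_Cartesian_Product.mat 1"
    using someI_ex[OF X_invertible[unfolded invertible_def]] unfolding matrix_inv_def by (rule conjunct2, rule conjunct1)
  show "(\<Sum>i\<in>UNIV. Z k i * X l i) = (if k = l then 1 else 0)"
    using arg_cong[OF inv(1), of "\<lambda>A. A $ k $ l"] by (simp add: matrix_matrix_mult_def Z_def Finite_Cartesian_Product.mat_def)
  show "(\<Sum>k\<in>UNIV. X k i * Z k j) = (if i = j then 1 else 0)"
    using arg_cong[OF inv(2), of "\<lambda>A. A $ i $ j"] by (simp add: matrix_matrix_mult_def Z_def Finite_Cartesian_Product.mat_def)
qed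

lemma X_Z_cancel: "(\<Sum>k\<in>UNIV. X k i * (\<Sum>j\<in>UNIV. Z k j * v j)) = v i"
proof -
  have "(\<Sum>k\<in>UNIV. X k i * (\<Sum>j\<in>UNIV. Z k j * v j)) = (\<Sum>j\<in>UNIV. (\<Sum>k\<in>UNIV. X k i * Z k j) * v j)"
    unfolding sum_distrib_left sum_distrib_right
    by (subst sum.swap) (simp add: algebra_simps)
  also have "\<dots> = (\<Sum>j\<in>UNIV. if i = j then v j else 0)"
    unfolding X_Z by (rule sum.cong) auto
  finally show ?thesis
    by simp
qed

lemma shift_solution:
  assumes "solves_VE D a (Suc s) (x(Suc s := y))" "\<And>k. D (c k) = 0"
  shows "solves_VE D a (Suc s) (x(Suc s := \<lambda>i. y i + (\<Sum>k\<in>UNIV. X k i * c k)))"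
    (is "solves_VE D a (Suc s) ?x'")
proof -
  let ?x = "x(Suc s := y)"
  have eq: "forcing a (Suc s) ?x' i = forcing a (Suc s) ?x i" for i
    by (rule forcing_cong) auto
  have "D (\<Sum>k\<in>UNIV. X k i * c k) = (\<Sum>j\<in>UNIV. a [j] i * (\<Sum>k\<in>UNIV. X k j * c k))" for i
  proof -
    have "D (\<Sum>k\<in>UNIV. X k i * c k) = (\<Sum>k\<in>UNIV. \<Sum>j\<in>UNIV. a [j] i * X k j * c k)"
      by (simp add: D_sum D_mult assms(2) D_X sum_distrib_right)
    also have "\<dots> = (\<Sum>j\<in>UNIV. a [j] i * (\<Sum>k\<in>UNIV. X k j * c k))"
      by (subst sum.swap) (simp add: sum_distrib_left algebra_simps)
    finally show ?thesis .
  qed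
  moreover have "solves_VE D a s ?x'"
    using assms(1) by (subst solves_VE_cong[of s _ ?x]) (auto intro: solves_VE_mono)
  ultimately show ?thesis
    using assms(1) by (simp add: solves_VE_Suc eq D_add distrib_left sum.distrib)
qed

text \<open>Also for \<open>s = 0\<close>, where every \<open>x\<close> is a solution of the empty system and \<open>x\<^sub>1 = 0\<close> continues it.\<close>

lemma extend_solution:
  assumes "solves_VE D a s x"
  shows "\<exists>y. solves_VE D a (Suc s) (x(Suc s := y))"
proof (cases "s = 0")
  case True
  have "solves_VE D a (Suc s) (x(Suc s := \<lambda>_. 0))"
    by (simp add: True solves_VE_Suc) (simp add: solves_VE_def)
  then show ?thesis by blast
next
  case False
  then show ?thesis
    using all_solutions assms by (auto simp: contains_all_solutions_def)
qed

text \<open>The conditions on \<open>x\<close> are dropped one equation after the other, from the last to the first: if \<open>P\<close>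
  vanishes at all solutions of \<open>VE\<^sub>s\<^sub>+\<^sub>1\<close>, with arbitrary values for the later unknowns, then for a fixed
  solution of \<open>VE\<^sub>s\<close> it vanishes at \<open>x\<^sub>s\<^sub>+\<^sub>1 = y + X c\<close> for all constant \<open>c\<close>, therefore for all \<open>c\<close> whatsoever,
  and \<open>X\<close> is invertible.\<close>

lemma vanishing_on_solutions:
  assumes "wpoly L w P" "\<And>x. solves_VE D a p x \<Longrightarrow> P x = 0"
  shows "P x = 0"
proof -
  have "\<forall>x. solves_VE D a s x \<longrightarrow> P x = 0" if "s \<le> p" for s
    using that
  proof (induction s rule: inc_induct)
    case base
    then show ?case using assms(2) by blast
  next
    case (step s)
    show ?case
    proof (intro allI impI)
      fix x assume x: "solves_VE D a s x"
      obtain y where y: "solves_VE D a (Suc s) (x(Suc s := y))"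
        using extend_solution[OF x] by blast
      let ?x = "\<lambda>c. x(Suc s := \<lambda>i. y i + (\<Sum>k\<in>UNIV. X k i * c k))"
      have "P (?x c) = 0" for c
      proof (rule polyfun_vanishing[OF polyfun_affine_substitution[OF assms(1)] infinite_range_iota])
        fix c :: "'m \<Rightarrow> 'a" assume "\<forall>k. c k \<in> range \<iota>"
        then have "solves_VE D a (Suc s) (?x c)"
          by (intro shift_solution[OF y]) (simp add: D_eq_0_iff)
        then show "P (?x c) = 0"
          using step.IH by blast
      qed
      \<comment> \<open>The coordinates for which \<open>y + X c\<close> is the given \<open>x\<^sub>s\<^sub>+\<^sub>1\<close>.\<close>
      from this[of "\<lambda>k. \<Sum>j\<in>UNIV. Z k j * (x (Suc s) j - y j)"]
      show "P x = 0"
        unfolding X_Z_cancel by (simp add: fun_upd_idem)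
    qed
  qed
  from this[of 0] show ?thesis
    by (simp add: solves_VE_def)
qed

text \<open>\<open>x\<^sub>k' = variational_rhs\<close> has weight \<open>k\<close> as \<open>x\<^sub>k\<close> has, and the product rule respects weights. It is essential
  that \<open>Q\<close> is the same for all solutions.\<close>

lemma D_wpoly:
  assumes "wpoly K w P" "w \<le> p"
  shows "\<exists>Q. wpoly K w Q \<and> (\<forall>x. solves_VE D a p x \<longrightarrow> D (P x) = Q x)"
  using assms
proof (induction rule: wpoly.induct)
  case (const c w)
  then show ?case
    by (intro exI[of _ "\<lambda>_. D c"]) (auto intro: wpoly.const diff_subfieldD[OF K])
next
  case (var k w j)
  then show ?case
    by (intro exI[of _ "\<lambda>x. variational_rhs a k x j"])
       (auto simp: solves_VE_def intro: wpoly_mono[OF variational_rhs_wpoly[OF K coeffs]])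
next
  case (add w P Q)
  then obtain P' Q' where "wpoly K w P'" "wpoly K w Q'"
    "\<forall>x. solves_VE D a p x \<longrightarrow> D (P x) = P' x" "\<forall>x. solves_VE D a p x \<longrightarrow> D (Q x) = Q' x"
    by blast
  then show ?case
    by (intro exI[of _ "\<lambda>x. P' x + Q' x"]) (auto simp: D_add intro: wpoly.add)
next
  case (mult u P v Q w)
  then obtain P' Q' where *: "wpoly K u P'" "wpoly K v Q'"
    "\<forall>x. solves_VE D a p x \<longrightarrow> D (P x) = P' x" "\<forall>x. solves_VE D a p x \<longrightarrow> D (Q x) = Q' x"
    by (metis add_leD1 add_leD2 le_trans)
  then show ?case
    using mult.hyps
    by (intro exI[of _ "\<lambda>x. P' x * Q x + P x * Q' x"]) (auto simp: D_mult intro!: wpoly.add wpoly.mult[of K u _ v])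
qed

text \<open>The linear system over \<open>K\<close> for the vector of monomials.\<close>

lemma D_monomials:
  "\<exists>B. (\<forall>M N. B M N \<in> K) \<and> (\<forall>M\<in>monomials p. \<forall>x. solves_VE D a p x \<longrightarrow>
     D (monomial M x) = (\<Sum>N\<in>monomials p. B M N * monomial N x))"
proof -
  have "\<exists>b. (\<forall>N. b N \<in> K) \<and> (M \<in> monomials p \<longrightarrow> (\<forall>x. solves_VE D a p x \<longrightarrow>
     D (monomial M x) = (\<Sum>N\<in>monomials p. b N * monomial N x)))" for M :: "(nat \<times> 'm) multiset"
  proof (cases "M \<in> monomials p")
    case True
    obtain Q where Q: "wpoly K p Q" "\<forall>x. solves_VE D a p x \<longrightarrow> D (monomial M x) = Q x"
      using D_wpoly[OF monomial_wpoly[OF True diff_subfieldD(1)[OF K]] order_refl] by blast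
    then show ?thesis
      using wpoly_monomial_span[OF Q(1) K] unfolding monomial_span_def by fastforce
  next
    case False
    then show ?thesis
      using diff_subfield_0[OF K] by (intro exI[of _ "\<lambda>_. 0"]) auto
  qed
  then show ?thesis by metis
qed

end


section \<open>Linear systems and fundamental matrices\<close>

text \<open>The points are found one at a time. With
  points for the first \<open>n\<close> functions found, the determinant of size \<open>n + 1\<close> with a variable last point is, by
  expansion along the last column, a combination of all functions in which the last one has a nonzero
  coefficient; so it does not vanish on all of \<open>S\<close>.\<close>

lemma exists_invertible_evaluation:
  fixes e :: "nat \<Rightarrow> 'b \<Rightarrow> 'a::field"
  assumes "\<And>c k. (\<And>x. x \<in> S \<Longrightarrow> (\<Sum>k<n. c k * e k x) = 0) \<Longrightarrow> k < n \<Longrightarrow> c k = 0"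
  shows "\<exists>xs. (\<forall>l<n. xs l \<in> S) \<and> det (mat n n (\<lambda>(k, l). e k (xs l))) \<noteq> 0"
  using assms
proof (induction n)
  case 0
  have "mat 0 0 (\<lambda>(k, l). e k (xs l)) = 1\<^sub>m 0" for xs
    by (rule eq_matI) auto
  then show ?case by simp
next
  case (Suc n)
  have "c k = 0" if "\<And>x. x \<in> S \<Longrightarrow> (\<Sum>k<n. c k * e k x) = 0" "k < n" for c k
    using Suc.prems[of "c(n := 0)" k] that by simp
  then obtain xs where xs: "\<forall>l<n. xs l \<in> S" "det (mat n n (\<lambda>(k, l). e k (xs l))) \<noteq> 0"
    using Suc.IH by blast
  define A where "A x = mat (Suc n) (Suc n) (\<lambda>(k, l). e k ((xs(n := x)) l))" for x
  define c where "c k = cofactor (A undefined) k n" for k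
  have del: "mat_delete (A x) k n = mat_delete (A undefined) k n" for x k
    by (rule eq_matI) (auto simp: A_def mat_delete_def)
  have cof: "cofactor (A x) k n = c k" for x k
    unfolding c_def cofactor_def by (subst del) (rule refl)
  have det_A: "det (A x) = (\<Sum>k<Suc n. c k * e k x)" for x
  proof -
    have "det (A x) = (\<Sum>k<Suc n. A x $$ (k, n) * cofactor (A x) k n)"
      by (rule laplace_expansion_column) (auto simp: A_def)
    also have "\<dots> = (\<Sum>k<Suc n. c k * e k x)"
      unfolding cof by (rule sum.cong) (auto simp: A_def)
    finally show ?thesis .
  qed
  have "mat_delete (A undefined) n n = mat n n (\<lambda>(k, l). e k (xs l))"
    by (rule eq_matI) (auto simp: A_def mat_delete_def)
  then have "c n \<noteq> 0"
    using xs(2) by (simp add: c_def cofactor_def)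
  then obtain x where x: "x \<in> S" "det (A x) \<noteq> 0"
    using Suc.prems[of c n] det_A by auto
  show ?case
  proof (intro exI conjI)
    show "\<forall>l<Suc n. (xs(n := x)) l \<in> S"
      using xs(1) x(1) by (auto simp: less_Suc_eq)
    show "det (mat (Suc n) (Suc n) (\<lambda>(k, l). e k ((xs(n := x)) l))) \<noteq> 0"
      using x(2) unfolding A_def .
  qed
qed

lemma invertible_mat_obtain_inverse:
  assumes "invertible_mat Y" "Y \<in> carrier_mat m m"
  obtains V where "V \<in> carrier_mat m m" "V * Y = 1\<^sub>m m" "Y * V = 1\<^sub>m m"
proof -
  obtain V where V: "inverts_mat Y V" "inverts_mat V Y"
    using assms unfolding invertible_mat_def by auto
  have "dim_col (Y * V) = dim_col (1\<^sub>m m)" "dim_col (V * Y) = dim_col (1\<^sub>m (dim_row V))"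
    using V assms(2) by (simp_all only: inverts_mat_def carrier_matD) simp_all
  then have "V \<in> carrier_mat m m"
    using assms(2) by auto
  then show ?thesis
    using that[of V] V assms(2) by (auto simp: inverts_mat_def)
qed

lemma invertible_matI:
  assumes "Y \<in> carrier_mat m m" "V \<in> carrier_mat m m" "V * Y = 1\<^sub>m m" "Y * V = 1\<^sub>m m"
  shows "invertible_mat Y"
  using assms unfolding invertible_mat_def inverts_mat_def by auto

lemma det_nonzero_invertible_mat:
  fixes Y :: "'a::field mat"
  assumes "Y \<in> carrier_mat m m" "det Y \<noteq> 0"
  shows "invertible_mat Y"
proof -
  obtain V where V: "V * Y = 1\<^sub>m m" "V \<in> carrier_mat m m"
    using det_non_zero_imp_unit[OF assms, of "()"] by (auto simp: Units_def ring_mat_def)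
  then show ?thesis
    using mat_mult_left_right_inverse[OF V(2) assms(1) V(1)] assms(1) by (intro invertible_matI)
qed

lemma elements_matI': "i < m \<Longrightarrow> j < n \<Longrightarrow> A \<in> carrier_mat m n \<Longrightarrow> A $$ (i, j) \<in> elements_mat A"
  by (auto simp: elements_mat_def intro!: bexI[of _ i] imageI)

lemma elements_mat_subset_iff:
  "A \<in> carrier_mat m n \<Longrightarrow> elements_mat A \<subseteq> E \<longleftrightarrow> (\<forall>i<m. \<forall>j<n. A $$ (i, j) \<in> E)"
  using elements_matI'[of _ m _ n A] by auto

lemma index_mult_mat_sum:
  assumes "A \<in> carrier_mat m n" "B \<in> carrier_mat n k" "i < m" "j < k"
  shows "(A * B) $$ (i, j) = (\<Sum>l<n. A $$ (i, l) * B $$ (l, j))"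
  using assms by (auto simp: scalar_prod_def atLeast0LessThan intro!: sum.cong)

context differential_field
begin

lemma D_mat_mult:
  assumes "A \<in> carrier_mat m n" "B \<in> carrier_mat n k"
  shows "map_mat D (A * B) = map_mat D A * B + A * map_mat D B"
proof (rule eq_matI)
  fix i j
  assume "i < dim_row (map_mat D A * B + A * map_mat D B)" "j < dim_col (map_mat D A * B + A * map_mat D B)"
  then have ij: "i < m" "j < k"
    using assms by auto
  have DA: "map_mat D A \<in> carrier_mat m n" and DB: "map_mat D B \<in> carrier_mat n k"
    using assms by auto
  have "map_mat D (A * B) $$ (i, j) = D ((A * B) $$ (i, j))"
    using ij assms by (subst index_map_mat) auto
  also have "\<dots> = (\<Sum>l<n. map_mat D A $$ (i, l) * B $$ (l, j)) + (\<Sum>l<n. A $$ (i, l) * map_mat D B $$ (l, j))"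
    unfolding index_mult_mat_sum[OF assms ij] D_sum D_mult sum.distrib[symmetric]
    using ij assms by (intro sum.cong) auto
  also have "\<dots> = (map_mat D A * B) $$ (i, j) + (A * map_mat D B) $$ (i, j)"
    unfolding index_mult_mat_sum[OF DA assms(2) ij] index_mult_mat_sum[OF assms(1) DB ij] ..
  also have "\<dots> = (map_mat D A * B + A * map_mat D B) $$ (i, j)"
    using ij assms by (subst index_add_mat) auto
  finally show "map_mat D (A * B) $$ (i, j) = (map_mat D A * B + A * map_mat D B) $$ (i, j)" .
qed (use assms in auto)

lemma D_one_mat: "map_mat D (1\<^sub>m m) = 0\<^sub>m m m"
  by (rule eq_matI) auto

text \<open>Variation of constants: \<open>Y\<^sup>-\<^sup>1 U\<close> has derivative \<open>0\<close>. The derivative \<open>V'\<close> of the inverse \<open>V\<close> of \<open>Y\<close> is found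
  from \<open>(V Y)' = 0\<close>, that is, \<open>W Y = 0\<close> for \<open>W = V' + V B\<close>.\<close>

lemma solutions_of_linear_system:
  assumes Y: "Y \<in> carrier_mat m m" "invertible_mat Y" and B: "B \<in> carrier_mat m m"
    and DY: "map_mat D Y = B * Y" and U: "U \<in> carrier_mat m r" and DU: "map_mat D U = B * U"
  shows "\<exists>C\<in>carrier_mat m r. U = Y * map_mat \<iota> C"
proof -
  obtain V where V: "V \<in> carrier_mat m m" "V * Y = 1\<^sub>m m" "Y * V = 1\<^sub>m m"
    using invertible_mat_obtain_inverse Y by metis
  define W where "W = map_mat D V + V * B"
  have DV: "map_mat D V \<in> carrier_mat m m" and W: "W \<in> carrier_mat m m"
    using V B by (auto simp: W_def)
  have D_V_mult: "map_mat D (V * T) = W * T" if T: "T \<in> carrier_mat m s" "map_mat D T = B * T" for T s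
  proof -
    have "map_mat D (V * T) = map_mat D V * T + V * (B * T)"
      by (simp add: D_mat_mult[OF V(1) T(1)] T(2))
    also have "\<dots> = W * T"
      unfolding W_def using DV V(1) B T(1) by (simp add: add_mult_distrib_mat assoc_mult_mat[of V m m B m T s])
    finally show ?thesis .
  qed
  have "W * Y = 0\<^sub>m m m"
    using D_V_mult[OF Y(1) DY] by (simp add: V D_one_mat)
  then have "W * Y * V = 0\<^sub>m m m"
    using V by simp
  then have "W = 0\<^sub>m m m"
    using W V Y(1) by (simp add: assoc_mult_mat[of W m m Y m V m])
  then have const: "map_mat D (V * U) = 0\<^sub>m m r"
    using D_V_mult[OF U DU] U by simp
  have VU: "V * U \<in> carrier_mat m r"
    using V U by simp
  define C where "C = mat m r (\<lambda>(i, j). SOME c. (V * U) $$ (i, j) = \<iota> c)"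
  have "V * U = map_mat \<iota> C"
  proof (rule eq_matI)
    fix i j assume "i < dim_row (map_mat \<iota> C)" "j < dim_col (map_mat \<iota> C)"
    then have ij: "i < m" "j < r" by (auto simp: C_def)
    have "D ((V * U) $$ (i, j)) = map_mat D (V * U) $$ (i, j)"
      using ij VU by (subst index_map_mat) auto
    then have "D ((V * U) $$ (i, j)) = 0"
      unfolding const using ij by simp
    then have "\<exists>c. (V * U) $$ (i, j) = \<iota> c"
      unfolding D_eq_0_iff by blast
    from someI_ex[OF this] show "(V * U) $$ (i, j) = map_mat \<iota> C $$ (i, j)"
      using ij by (simp add: C_def)
  qed (use VU in \<open>auto simp: C_def\<close>)
  moreover have "U = Y * (V * U)"
    using V Y(1) U by (simp add: assoc_mult_mat[of Y m m V m U r, symmetric])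
  ultimately show ?thesis
    by (intro bexI[of _ C]) (auto simp: C_def)
qed

end

section \<open>The extensions generated by the solutions of the variational equations\<close>

context variational_equations
begin

lemma diff_subfield_PV_VE: "diff_subfield D (PV_VE D K a p)"
  unfolding PV_VE_def by (rule diff_subfield_adjoin)

lemma K_subset_PV_VE: "K \<subseteq> PV_VE D K a p"
  unfolding PV_VE_def by (rule adjoin_superset)

lemma solution_in_PV_VE:
  "solves_VE D a p x \<Longrightarrow> 1 \<le> q \<Longrightarrow> q \<le> p \<Longrightarrow> x q i \<in> PV_VE D K a p"
  unfolding PV_VE_def by (rule subsetD[OF adjoin_superset(2)]) auto

lemma PV_VE_least:
  assumes "diff_subfield D E" "K \<subseteq> E"
    "\<And>x q i. solves_VE D a p x \<Longrightarrow> 1 \<le> q \<Longrightarrow> q \<le> p \<Longrightarrow> x q i \<in> E"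
  shows "PV_VE D K a p \<subseteq> E"
  unfolding PV_VE_def by (rule adjoin_least) (use assms in auto)

text \<open>The columns of the fundamental matrix are the vectors of monomials at finitely many solutions. That these
  entries generate all of \<open>PV(VE\<^sub>p)\<close> follows from uniqueness: the vector of monomials at any other solution is a
  combination of the columns with constant coefficients, and the monomials of degree one are the
  components of this solution.\<close>

theorem fundamental_matrix_PV_VE: "\<exists>n Y. fundamental_matrix D K (PV_VE D K a p) n Y"
proof -
  define Ms where "Ms = (monomials p :: (nat \<times> 'm) multiset set)"
  define n where "n = card Ms"
  obtain e where e: "bij_betw e {..<n} Ms"
    using ex_bij_betw_nat_finite[of Ms] finite_monomials by (auto simp: Ms_def n_def atLeast0LessThan)
  have e_in: "e k \<in> monomials p" if "k < n" for k
    using e that by (auto simp: bij_betw_def Ms_def)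
  have reindex: "(\<Sum>N\<in>Ms. g N) = (\<Sum>l<n. g (e l))" for g :: "(nat \<times> 'm) multiset \<Rightarrow> 'a"
    by (rule sum.reindex_bij_betw[OF e, symmetric])
  obtain B where B: "B M N \<in> K" and DM: "M \<in> monomials p \<Longrightarrow> solves_VE D a p x \<Longrightarrow>
      D (monomial M x) = (\<Sum>N\<in>monomials p. B M N * monomial N x)" for M N x
    using D_monomials[of p] by blast
  have indep: "c k = 0"
    if c: "\<And>x. x \<in> {x. solves_VE D a p x} \<Longrightarrow> (\<Sum>k<n. c k * monomial (e k) x) = 0" and k: "k < n"
    for c k
  proof -
    define d where "d N = c (inv_into {..<n} e N)" for N
    have d: "d (e l) = c l" if "l < n" for l
      using e that by (simp add: d_def bij_betw_def)
    have sum: "(\<Sum>N\<in>monomials p. d N * monomial N x) = (\<Sum>k<n. c k * monomial (e k) x)" for x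
      using reindex[of "\<lambda>N. d N * monomial N x"] d by (simp add: Ms_def)
    have "wpoly UNIV p (\<lambda>x. \<Sum>N\<in>monomials p. d N * monomial N x)"
      by (intro wpoly_sum wpoly_scale monomial_wpoly) auto
    then have "(\<Sum>N\<in>monomials p. d N * monomial N x) = 0" for x
      by (rule vanishing_on_solutions[of UNIV p _ p]) (use c sum in auto)
    then have "d (e k) = 0"
      by (rule monomials_independent) (rule e_in[OF k])
    then show "c k = 0"
      using d[OF k] by simp
  qed
  have "\<exists>xs. (\<forall>l<n. xs l \<in> {x. solves_VE D a p x}) \<and>
      det (mat n n (\<lambda>(k, l). monomial (e k) (xs l))) \<noteq> 0"
  proof (rule exists_invertible_evaluation)
    fix c k
    assume "\<And>x. x \<in> {x. solves_VE D a p x} \<Longrightarrow> (\<Sum>k<n. c k * monomial (e k) x) = 0" "k < n"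
    then show "c k = 0" by (rule indep[of c k])
  qed
  then obtain xs where xs: "\<forall>l<n. xs l \<in> {x. solves_VE D a p x}"
    and det: "det (mat n n (\<lambda>(k, l). monomial (e k) (xs l))) \<noteq> 0"
    by blast
  define Y where "Y = mat n n (\<lambda>(k, l). monomial (e k) (xs l))"
  define Bm where "Bm = mat n n (\<lambda>(k, l). B (e k) (e l))"
  have Y: "Y \<in> carrier_mat n n" and Bm: "Bm \<in> carrier_mat n n"
    by (auto simp: Y_def Bm_def)
  have Y_inv: "invertible_mat Y"
    by (rule det_nonzero_invertible_mat[OF Y]) (use det in \<open>simp add: Y_def\<close>)
  have D_eq: "D (monomial (e k) x) = (\<Sum>l<n. Bm $$ (k, l) * monomial (e l) x)"
    if "k < n" "solves_VE D a p x" for k x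
    using DM[OF e_in[OF that(1)] that(2)] reindex[of "\<lambda>N. B (e k) N * monomial N x"] that(1)
    by (simp add: Ms_def Bm_def)
  have DY: "map_mat D Y = Bm * Y"
  proof (rule eq_matI)
    fix i j assume "i < dim_row (Bm * Y)" "j < dim_col (Bm * Y)"
    then have ij: "i < n" "j < n" using Y Bm by auto
    then show "map_mat D Y $$ (i, j) = (Bm * Y) $$ (i, j)"
      using D_eq[of i "xs j"] xs Y by (subst index_mult_mat_sum[OF Bm Y]) (auto simp: Y_def)
  qed (use Y Bm in auto)
  have "PV_VE D K a p = adjoin D K (elements_mat Y)"
  proof
    show "adjoin D K (elements_mat Y) \<subseteq> PV_VE D K a p"
    proof (rule adjoin_least[OF diff_subfield_PV_VE K_subset_PV_VE])
      have "monomial (e k) (xs l) \<in> PV_VE D K a p" if "k < n" "l < n" for k l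
        by (rule wpoly_value[OF monomial_wpoly[OF e_in] diff_subfield_PV_VE K_subset_PV_VE])
           (use that xs solution_in_PV_VE diff_subfieldD(1)[OF K] in auto)
      then show "elements_mat Y \<subseteq> PV_VE D K a p"
        unfolding elements_mat_subset_iff[OF Y] by (auto simp: Y_def)
    qed
    let ?E = "adjoin D K (elements_mat Y)"
    have E: "diff_subfield D ?E" "K \<subseteq> ?E" "elements_mat Y \<subseteq> ?E"
      by (rule diff_subfield_adjoin adjoin_superset)+
    show "PV_VE D K a p \<subseteq> ?E"
    proof (rule PV_VE_least[OF E(1,2)])
      fix x q i assume x: "solves_VE D a p x" and q: "1 \<le> q" "q \<le> p"
      define U where "U = mat n 1 (\<lambda>(k, _). monomial (e k) x)"
      have U: "U \<in> carrier_mat n 1" by (simp add: U_def)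
      have "map_mat D U = Bm * U"
      proof (rule eq_matI)
        fix i j assume "i < dim_row (Bm * U)" "j < dim_col (Bm * U)"
        then have ij: "i < n" "j < 1" using U Bm by auto
        then show "map_mat D U $$ (i, j) = (Bm * U) $$ (i, j)"
          using D_eq[OF _ x, of i] by (subst index_mult_mat_sum[OF Bm U]) (auto simp: U_def)
      qed (use U Bm in auto)
      then obtain C where C: "C \<in> carrier_mat n 1" "U = Y * map_mat \<iota> C"
        using solutions_of_linear_system[OF Y Y_inv Bm DY U] by blast
      have "{#(q, i)#} \<in> Ms"
        using q by (simp add: Ms_def monomials_def)
      then obtain k where k: "k < n" "e k = {#(q, i)#}"
        using e by (auto simp: bij_betw_def)
      have "x q i = U $$ (k, 0)"
        using k by (simp add: U_def monomial_def)
      also have "\<dots> = (\<Sum>l<n. Y $$ (k, l) * \<iota> (C $$ (l, 0)))"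
        unfolding C(2) using C(1) k(1) by (subst index_mult_mat_sum[OF Y]) auto
      also have "\<dots> \<in> ?E"
        using E(2) iota_in_K subsetD[OF E(3) elements_matI'[OF k(1) _ Y]]
        by (intro diff_subfield_sum[OF E(1)] diff_subfieldD(3)[OF E(1)]) auto
      finally show "x q i \<in> ?E" .
    qed
  qed
  moreover have "elements_mat Bm \<subseteq> K"
    unfolding elements_mat_subset_iff[OF Bm] using B by (auto simp: Bm_def)
  ultimately have "fundamental_matrix D K (PV_VE D K a p) n Y"
    unfolding fundamental_matrix_def using Y Y_inv Bm DY by blast
  then show ?thesis by blast
qed

theorem picard_vessiot_PV_VE: "picard_vessiot D K (PV_VE D K a p)"
proof -
  have "PV_VE D K a p \<inter> constants D = K \<inter> constants D"
    using K_subset_PV_VE[of p] range_iota constants_eq by auto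
  then show ?thesis
    unfolding picard_vessiot_def
    using K diff_subfield_PV_VE K_subset_PV_VE fundamental_matrix_PV_VE by blast
qed

end


section \<open>Second level integrals\<close>

text \<open>More vectors than coordinates. Gaussian elimination of one coordinate at a time stays in the subfield \<open>E\<close>.\<close>

lemma linear_dependence_over_subfield:
  fixes v :: "'i \<Rightarrow> 'j \<Rightarrow> 'a::field"
  assumes E: "diff_subfield D E"
    and "finite J" "finite I" "card J < card I" "\<And>i j. i \<in> I \<Longrightarrow> j \<in> J \<Longrightarrow> v i j \<in> E"
  shows "\<exists>b. (\<forall>i\<in>I. b i \<in> E) \<and> (\<exists>i\<in>I. b i \<noteq> 0) \<and> (\<forall>j\<in>J. (\<Sum>i\<in>I. b i * v i j) = 0)"
  using assms(2-)
proof (induction J arbitrary: I v rule: finite_induct)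
  case empty
  then show ?case
    by (intro exI[of _ "\<lambda>_. 1"]) (auto simp: diff_subfieldD(1)[OF E] card_gt_0_iff)
next
  case (insert j J)
  show ?case
  proof (cases "\<forall>i\<in>I. v i j = 0")
    case True
    have "\<exists>b. (\<forall>i\<in>I. b i \<in> E) \<and> (\<exists>i\<in>I. b i \<noteq> 0) \<and> (\<forall>j\<in>J. (\<Sum>i\<in>I. b i * v i j) = 0)"
      using insert.prems insert.hyps by (intro insert.IH) auto
    then show ?thesis
      using True by simp
  next
    case False
    then obtain r where r: "r \<in> I" "v r j \<noteq> 0" by blast
    define I' where "I' = I - {r}"
    have I': "finite I'" "I = insert r I'" "r \<notin> I'"
      using insert.prems(1) r(1) by (auto simp: I'_def)
    define w where "w i l = v i l - v i j / v r j * v r l" for i l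
    have "\<exists>b. (\<forall>i\<in>I'. b i \<in> E) \<and> (\<exists>i\<in>I'. b i \<noteq> 0) \<and> (\<forall>l\<in>J. (\<Sum>i\<in>I'. b i * w i l) = 0)"
    proof (rule insert.IH[OF I'(1)])
      show "card J < card I'"
        using insert.prems(2) insert.hyps I' by simp
      show "w i l \<in> E" if "i \<in> I'" "l \<in> J" for i l
        using that insert.prems(3) I' unfolding w_def by (intro diff_subfield_closed[OF E]) auto
    qed
    then obtain b where b: "\<forall>i\<in>I'. b i \<in> E" "\<exists>i\<in>I'. b i \<noteq> 0"
      "\<forall>l\<in>J. (\<Sum>i\<in>I'. b i * w i l) = 0" by blast
    \<comment> \<open>The coefficient of the pivot vector \<open>r\<close> that restores the eliminated coordinate \<open>j\<close>.\<close>
    define s where "s = - (\<Sum>i\<in>I'. b i * v i j) / v r j"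
    have "(\<Sum>i\<in>I. (b(r := s)) i * v i l) = 0" if "l \<in> insert j J" for l
    proof -
      have "(\<Sum>i\<in>I. (b(r := s)) i * v i l) = s * v r l + (\<Sum>i\<in>I'. b i * v i l)"
        using I' by (auto intro!: sum.cong)
      also have "\<dots> = (\<Sum>i\<in>I'. b i * w i l)"
        by (simp add: s_def w_def right_diff_distrib sum_subtractf sum_divide_distrib sum_distrib_right
            sum_distrib_left field_simps)
      also have "\<dots> = 0"
        using that b(3) r(2) by (auto simp: w_def)
      finally show ?thesis .
    qed
    moreover have "s \<in> E"
      unfolding s_def using b(1) insert.prems(3) I'
      by (intro diff_subfield_closed[OF E] diff_subfield_sum[OF E]) auto
    moreover have "\<exists>i\<in>I. (b(r := s)) i \<noteq> 0"
      using b(2) I' by auto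
    ultimately show ?thesis
      using b(1) I'(2) by (intro exI[of _ "b(r := s)"]) auto
  qed
qed

context differential_field
begin

text \<open>All derivatives of \<open>y\<close> are combinations over \<open>K\<close> of the \<open>g j\<close>, so \<open>card J + 1\<close> of them are linearly dependent
  over \<open>K\<close>.\<close>

lemma PV_ring_from_linear_system:
  assumes K: "diff_subfield D K" and "finite J"
    and Dg: "\<And>j. j \<in> J \<Longrightarrow> D (g j) = (\<Sum>l\<in>J. B j l * g l)"
    and B: "\<And>j l. j \<in> J \<Longrightarrow> l \<in> J \<Longrightarrow> B j l \<in> K"
    and c: "\<And>j. j \<in> J \<Longrightarrow> c j \<in> K" and y: "y = (\<Sum>j\<in>J. c j * g j)" "y \<in> F"
  shows "y \<in> PV_ring D K F"
proof -
  have "\<exists>c. (\<forall>j\<in>J. c j \<in> K) \<and> (D ^^ k) y = (\<Sum>j\<in>J. c j * g j)" for k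
  proof (induction k)
    case 0
    then show ?case using c y by auto
  next
    case (Suc k)
    then obtain c where c: "\<forall>j\<in>J. c j \<in> K" "(D ^^ k) y = (\<Sum>j\<in>J. c j * g j)" by blast
    let ?c = "\<lambda>l. D (c l) + (\<Sum>j\<in>J. c j * B j l)"
    have "(D ^^ Suc k) y = (\<Sum>j\<in>J. D (c j) * g j) + (\<Sum>j\<in>J. \<Sum>l\<in>J. c j * B j l * g l)"
      by (simp add: c(2) D_sum D_mult sum.distrib Dg sum_distrib_left mult.assoc)
    also have "\<dots> = (\<Sum>l\<in>J. ?c l * g l)"
      by (subst sum.swap) (simp add: sum.distrib distrib_right sum_distrib_right)
    finally show ?case
      using c(1) B
      by (intro exI[of _ ?c]) (auto intro!: diff_subfield_closed[OF K] diff_subfield_sum[OF K])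
  qed
  then obtain v where v: "\<And>k j. j \<in> J \<Longrightarrow> v k j \<in> K" "\<And>k. (D ^^ k) y = (\<Sum>j\<in>J. v k j * g j)"
    by metis
  define m where "m = card J"
  obtain b where b: "\<forall>k\<in>{..m}. b k \<in> K" "\<exists>k\<in>{..m}. b k \<noteq> 0"
    "\<forall>j\<in>J. (\<Sum>k\<in>{..m}. b k * v k j) = 0"
    using linear_dependence_over_subfield[OF K \<open>finite J\<close>, of "{..m}" v] v(1) by (auto simp: m_def)
  have "(\<Sum>k\<le>m. b k * (D ^^ k) y) = (\<Sum>j\<in>J. (\<Sum>k\<le>m. b k * v k j) * g j)"
    unfolding v(2) sum_distrib_left sum_distrib_right by (subst sum.swap) (simp add: mult.assoc)
  also have "\<dots> = 0"
    using b(3) by simp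
  finally show ?thesis
    unfolding PV_ring_def using b(1,2) y(2) by auto
qed

end

context variational_equations
begin

lemma PV_VE_subset_Suc: "PV_VE D K a p \<subseteq> PV_VE D K a (Suc p)"
proof (rule PV_VE_least[OF diff_subfield_PV_VE K_subset_PV_VE])
  fix x q i assume x: "solves_VE D a p x" and q: "1 \<le> q" "q \<le> p"
  obtain y where "solves_VE D a (Suc p) (x(Suc p := y))"
    using extend_solution[OF x] by blast
  from solution_in_PV_VE[OF this q(1), of i] show "x q i \<in> PV_VE D K a (Suc p)"
    using q by auto
qed

lemma PV_VE_mono: "p \<le> q \<Longrightarrow> PV_VE D K a p \<subseteq> PV_VE D K a q"
  by (rule lift_Suc_mono_le[of "PV_VE D K a"]) (rule PV_VE_subset_Suc)

lemma X_in_PV_VE: "1 \<le> p \<Longrightarrow> X k i \<in> PV_VE D K a p"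
  using solution_in_PV_VE[OF X_solves, of 1 k i] PV_VE_mono[of 1 p] by auto

text \<open>\<open>Z = X\<^sup>-\<^sup>1\<close> solves the adjoint system \<open>Z' = - Z A\<close>.\<close>

lemma D_Z: "D (Z k j) = - (\<Sum>i\<in>UNIV. Z k i * a [j] i)"
proof -
  define W where "W j = D (Z k j) + (\<Sum>i\<in>UNIV. Z k i * a [j] i)" for j
  have W: "(\<Sum>j\<in>UNIV. W j * X l j) = 0" for l
  proof -
    have "D (\<Sum>i\<in>UNIV. Z k i * X l i) = 0"
      unfolding Z_X by simp
    moreover have "(\<Sum>i\<in>UNIV. \<Sum>j\<in>UNIV. Z k i * (a [j] i * X l j))
        = (\<Sum>j\<in>UNIV. \<Sum>i\<in>UNIV. Z k i * (a [j] i * X l j))"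
      by (rule sum.swap)
    ultimately show ?thesis
      by (simp add: W_def D_sum D_mult D_X sum.distrib distrib_right sum_distrib_left
          sum_distrib_right mult.assoc)
  qed
  have "W j = (\<Sum>i\<in>UNIV. W i * (\<Sum>l\<in>UNIV. X l i * Z l j))"
    by (simp add: X_Z if_distrib[of "(*) _"] cong: if_cong)
  also have "\<dots> = (\<Sum>l\<in>UNIV. (\<Sum>i\<in>UNIV. W i * X l i) * Z l j)"
    unfolding sum_distrib_left sum_distrib_right by (subst sum.swap) (simp add: mult.assoc)
  also have "\<dots> = 0"
    unfolding W by simp
  finally show ?thesis
    by (simp add: W_def eq_neg_iff_add_eq_0)
qed

text \<open>The \<open>k\<close>-th unit vector and the rows of \<open>X\<close> are one vector too many for the dimension. The coefficients of
  a dependence between them over \<open>PV(VE\<^sub>p)\<close> are, up to a common factor, row \<open>k\<close> of \<open>X\<^sup>-\<^sup>1\<close>.\<close>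

lemma Z_in_PV_VE:
  assumes "1 \<le> p"
  shows "Z k j \<in> PV_VE D K a p"
proof -
  let ?F = "PV_VE D K a p"
  let ?v = "\<lambda>i l. case i of None \<Rightarrow> (if k = l then 1 else 0) | Some i \<Rightarrow> X l i"
  have "\<exists>b. (\<forall>i\<in>UNIV. b i \<in> ?F) \<and> (\<exists>i\<in>UNIV. b i \<noteq> 0) \<and>
          (\<forall>l\<in>UNIV. (\<Sum>i\<in>UNIV. b i * ?v i l) = 0)"
    by (rule linear_dependence_over_subfield[OF diff_subfield_PV_VE])
       (auto simp: card_UNIV_option X_in_PV_VE[OF assms] diff_subfield_closed[OF diff_subfield_PV_VE]
         split: option.split)
  then obtain b where b: "\<And>i. b i \<in> ?F" "\<exists>i. b i \<noteq> 0" "\<And>l. (\<Sum>i\<in>UNIV. b i * ?v i l) = 0"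
    by blast
  have rel: "(\<Sum>i\<in>UNIV. b (Some i) * X l i) = - b None * (if k = l then 1 else 0)" for l
  proof -
    have "(\<Sum>i\<in>UNIV. b i * ?v i l) = b None * (if k = l then 1 else 0) + (\<Sum>i\<in>UNIV. b (Some i) * X l i)"
      unfolding UNIV_option_conv by (subst sum.insert) (auto simp: sum.reindex)
    then show ?thesis
      using b(3)[of l] by (simp add: eq_neg_iff_add_eq_0 add.commute)
  qed
  have coord: "b (Some i) = - b None * Z k i" for i
  proof -
    have "b (Some i) = (\<Sum>j\<in>UNIV. b (Some j) * (\<Sum>l\<in>UNIV. X l j * Z l i))"
      by (simp add: X_Z if_distrib[of "(*) _"] cong: if_cong)
    also have "\<dots> = (\<Sum>l\<in>UNIV. (\<Sum>j\<in>UNIV. b (Some j) * X l j) * Z l i)"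
      unfolding sum_distrib_left sum_distrib_right by (subst sum.swap) (simp add: mult.assoc)
    also have "\<dots> = (\<Sum>l\<in>UNIV. if k = l then - b None * Z k i else 0)"
      unfolding rel by (rule sum.cong) auto
    finally show ?thesis by simp
  qed
  have "b None \<noteq> 0"
  proof
    assume "b None = 0"
    then have "b i = 0" for i
      using coord by (cases i) auto
    then show False using b(2) by blast
  qed
  then have "Z k j = - b (Some j) / b None"
    using coord[of j] by (simp add: field_simps)
  then show ?thesis
    using b(1) by (auto intro!: diff_subfield_closed[OF diff_subfield_PV_VE])
qed

text \<open>The vector \<open>c = X\<^sup>-\<^sup>1 x\<^sub>p\<close> of the variation of constants.\<close>

definition integral_coordinate :: "nat \<Rightarrow> (nat \<Rightarrow> 'm \<Rightarrow> 'a) \<Rightarrow> 'm \<Rightarrow> 'a" where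
  "integral_coordinate p x k = (\<Sum>i\<in>UNIV. Z k i * x p i)"

lemma solution_eq_integral_coordinates:
  "x p i = (\<Sum>k\<in>UNIV. X k i * integral_coordinate p x k)"
  unfolding integral_coordinate_def by (rule X_Z_cancel[symmetric])

lemma D_integral_coordinate:
  assumes "solves_VE D a (Suc p) x"
  shows "D (integral_coordinate (Suc p) x k) = (\<Sum>i\<in>UNIV. Z k i * forcing a (Suc p) x i)"
proof -
  let ?s = "\<Sum>i\<in>UNIV. \<Sum>j\<in>UNIV. Z k j * a [i] j * x (Suc p) i"
  have "D (x (Suc p) i) = (\<Sum>j\<in>UNIV. a [j] i * x (Suc p) j) + forcing a (Suc p) x i" for i
    using assms by (simp add: solves_VE_Suc)
  then have "D (integral_coordinate (Suc p) x k) =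
      - ?s + ((\<Sum>i\<in>UNIV. \<Sum>j\<in>UNIV. Z k i * a [j] i * x (Suc p) j) + (\<Sum>i\<in>UNIV. Z k i * forcing a (Suc p) x i))"
    unfolding integral_coordinate_def
    by (simp add: D_sum D_mult D_Z sum.distrib distrib_left sum_distrib_left sum_distrib_right
        sum_negf sum_subtractf mult.assoc)
  moreover have "(\<Sum>i\<in>UNIV. \<Sum>j\<in>UNIV. Z k i * a [j] i * x (Suc p) j) = ?s"
    by (rule sum.swap)
  ultimately show ?thesis by simp
qed

text \<open>The products of the entries of row \<open>k\<close> of \<open>X\<^sup>-\<^sup>1\<close> with the monomials at \<open>x\<close> solve a linear system over \<open>K\<close>, and
  the derivative of the integral is a combination of them. Its membership in \<open>PV(VE\<^sub>p)\<close>, although the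
  monomials also involve \<open>x\<^sub>p\<^sub>+\<^sub>1\<close>, comes from \<open>forcing\<close> being free of that unknown.\<close>

lemma D_integral_coordinate_in_PV_ring:
  assumes x: "solves_VE D a (Suc p) x" and "1 \<le> p"
  shows "D (integral_coordinate (Suc p) x k) \<in> PV_ring D K (PV_VE D K a p)"
proof -
  let ?Ms = "monomials (Suc p) :: (nat \<times> 'm) multiset set"
  obtain B where B: "B M N \<in> K" and DM: "M \<in> ?Ms \<Longrightarrow>
      D (monomial M x) = (\<Sum>N\<in>?Ms. B M N * monomial N x)" for M N
    using D_monomials[of "Suc p"] x by blast
  have "\<exists>c. (\<forall>M. c M \<in> K) \<and> forcing a (Suc p) x i = (\<Sum>M\<in>?Ms. c M * monomial M x)" for i
    using wpoly_monomial_span[OF forcing_wpoly[where a = a and q = "Suc p" and i = i, OF K coeffs] K]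
    unfolding monomial_span_def by blast
  then obtain c where c: "\<And>i M. c i M \<in> K" "\<And>i. forcing a (Suc p) x i = (\<Sum>M\<in>?Ms. c i M * monomial M x)"
    by metis
  define g where "g = (\<lambda>(i, M). Z k i * monomial M x)"
  define b where "b = (\<lambda>(i, M) (j, N). (if N = M then - a [i] j else 0) + (if j = i then B M N else 0))"
  show ?thesis
  proof (rule PV_ring_from_linear_system[OF K, of "UNIV \<times> ?Ms" g b "\<lambda>(i, M). c i M"])
    show "finite ((UNIV :: 'm set) \<times> ?Ms)"
      by (rule finite_cartesian_product[OF finite finite_monomials])
    fix v :: "'m \<times> (nat \<times> 'm) multiset" assume v: "v \<in> UNIV \<times> ?Ms"
    obtain i M where iM: "v = (i, M)" "M \<in> ?Ms"
      using v by (cases v) auto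
    show "b v u \<in> K" if "u \<in> UNIV \<times> ?Ms" for u
      using B coeffs by (cases u) (auto simp: b_def iM intro!: diff_subfield_closed[OF K])
    show "(case v of (i, M) \<Rightarrow> c i M) \<in> K"
      by (simp add: iM c)
    have "(\<Sum>u\<in>UNIV \<times> ?Ms. b v u * g u) = (\<Sum>j\<in>UNIV. \<Sum>N\<in>?Ms. b v (j, N) * g (j, N))"
      by (simp add: sum.cartesian_product)
    also have "\<dots> = (\<Sum>j\<in>UNIV. \<Sum>N\<in>?Ms. if N = M then - (a [i] j * (Z k j * monomial M x)) else 0)
        + (\<Sum>j\<in>UNIV. \<Sum>N\<in>?Ms. if j = i then B M N * (Z k i * monomial N x) else 0)"
      unfolding sum.distrib[symmetric] by (intro sum.cong) (auto simp: b_def g_def iM algebra_simps)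
    also have "(\<Sum>j\<in>UNIV. \<Sum>N\<in>?Ms. if j = i then B M N * (Z k i * monomial N x) else 0)
        = (\<Sum>N\<in>?Ms. B M N * (Z k i * monomial N x))"
      by (subst sum.swap) simp
    also have "(\<Sum>j\<in>UNIV. \<Sum>N\<in>?Ms. if N = M then - (a [i] j * (Z k j * monomial M x)) else 0)
        = (\<Sum>j\<in>UNIV. - (a [i] j * (Z k j * monomial M x)))"
      using iM(2) finite_monomials by (intro sum.cong refl, subst sum.delta) auto
    finally show "D (g v) = (\<Sum>u\<in>UNIV \<times> ?Ms. b v u * g u)"
      unfolding g_def iM(1) prod.case D_mult D_Z DM[OF iM(2)]
      by (simp add: sum_distrib_left sum_distrib_right sum_negf algebra_simps)
  next
    have "D (integral_coordinate (Suc p) x k) = (\<Sum>i\<in>UNIV. \<Sum>M\<in>?Ms. c i M * (Z k i * monomial M x))"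
      unfolding D_integral_coordinate[OF x] c(2) by (simp add: sum_distrib_left algebra_simps)
    then show "D (integral_coordinate (Suc p) x k) = (\<Sum>v\<in>UNIV \<times> ?Ms. (case v of (i, M) \<Rightarrow> c i M) * g v)"
      by (simp add: sum.cartesian_product g_def case_prod_unfold)
    show "D (integral_coordinate (Suc p) x k) \<in> PV_VE D K a p"
      unfolding D_integral_coordinate[OF x]
      by (intro diff_subfield_sum[OF diff_subfield_PV_VE] diff_subfieldD(3)[OF diff_subfield_PV_VE]
          Z_in_PV_VE[OF assms(2)] forcing_value[OF K coeffs diff_subfield_PV_VE K_subset_PV_VE]
          solution_in_PV_VE solves_VE_mono[OF x]) auto
  qed
qed

text \<open>\<open>PV(VE\<^sub>p\<^sub>+\<^sub>1)\<close> is generated over \<open>PV(VE\<^sub>p)\<close> by the integrals, since \<open>x\<^sub>p\<^sub>+\<^sub>1 = X c\<close>.\<close>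

lemma PV_VE_Suc_least:
  assumes "diff_subfield D E" "PV_VE D K a p \<subseteq> E" "1 \<le> p"
    "\<And>x k. solves_VE D a (Suc p) x \<Longrightarrow> integral_coordinate (Suc p) x k \<in> E"
  shows "PV_VE D K a (Suc p) \<subseteq> E"
proof (rule PV_VE_least[OF assms(1)])
  show "K \<subseteq> E"
    using K_subset_PV_VE assms(2) by blast
  fix x q i assume x: "solves_VE D a (Suc p) x" and q: "1 \<le> q" "q \<le> Suc p"
  show "x q i \<in> E"
  proof (cases "q = Suc p")
    case True
    have "X k i \<in> E" for k
      using X_in_PV_VE[OF assms(3)] assms(2) by blast
    then show ?thesis
      unfolding True solution_eq_integral_coordinates[of x "Suc p" i]
      using assms(4)[OF x] by (intro diff_subfield_sum[OF assms(1)] diff_subfieldD(3)[OF assms(1)])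
  next
    case False
    then show ?thesis
      using solution_in_PV_VE[OF solves_VE_mono[OF x, of p], of q i] q assms(2) by auto
  qed
qed

lemma integral_coordinate_in_PV_VE:
  assumes "solves_VE D a (Suc p) x"
  shows "integral_coordinate (Suc p) x k \<in> PV_VE D K a (Suc p)"
  unfolding integral_coordinate_def
  by (intro diff_subfield_sum[OF diff_subfield_PV_VE] diff_subfieldD(3)[OF diff_subfield_PV_VE]
      Z_in_PV_VE solution_in_PV_VE[OF assms]) auto

theorem generated_by_second_level_integrals_PV_VE:
  assumes "1 \<le> p"
  shows "generated_by_second_level_integrals D K (PV_VE D K a p) (PV_VE D K a (Suc p))"
proof -
  let ?F = "PV_VE D K a p" and ?F' = "PV_VE D K a (Suc p)"
  let ?S = "{\<Phi>. second_level_integral D K ?F ?F' \<Phi>}"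
  have "integral_coordinate (Suc p) x k \<in> ?S" if "solves_VE D a (Suc p) x" for x k
    using that assms picard_vessiot_PV_VE PV_VE_subset_Suc integral_coordinate_in_PV_VE
      D_integral_coordinate_in_PV_ring
    by (simp add: second_level_integral_def)
  then have "?F' \<subseteq> adjoin D ?F ?S"
    using adjoin_superset[of _ D] by (intro PV_VE_Suc_least[OF diff_subfield_adjoin _ assms]) blast+
  moreover have "adjoin D ?F ?S \<subseteq> ?F'"
    by (rule adjoin_least[OF diff_subfield_PV_VE PV_VE_subset_Suc]) (auto simp: second_level_integral_def)
  ultimately show ?thesis
    unfolding generated_by_second_level_integrals_def by blast
qed

end


section \<open>The differential Galois group\<close>

abbreviation galois :: "('a::field \<Rightarrow> 'a) \<Rightarrow> 'a set \<Rightarrow> 'a set \<Rightarrow> ('a \<Rightarrow> 'a) set" where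
  "galois D K F \<equiv> carrier (diff_gal D K F)"

lemma galois_def:
  "galois D K F = {\<sigma> \<in> Bij F. (\<forall>x\<in>F. \<forall>y\<in>F. \<sigma> (x + y) = \<sigma> x + \<sigma> y \<and> \<sigma> (x * y) = \<sigma> x * \<sigma> y) \<and>
     (\<forall>x\<in>F. \<sigma> (D x) = D (\<sigma> x)) \<and> (\<forall>x\<in>K. \<sigma> x = x)}"
  by (simp add: diff_gal_def)

lemma one_BijGroup: "\<one>\<^bsub>BijGroup F\<^esub> = (\<lambda>x\<in>F. x)"
  by (simp add: BijGroup_def)

lemma mult_BijGroup: "\<sigma> \<in> Bij F \<Longrightarrow> \<tau> \<in> Bij F \<Longrightarrow> \<sigma> \<otimes>\<^bsub>BijGroup F\<^esub> \<tau> = compose F \<sigma> \<tau>"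
  by (simp add: BijGroup_def)

lemma carrier_BijGroup: "carrier (BijGroup F) = Bij F"
  by (simp add: BijGroup_def)

lemma Bij_image: "\<sigma> \<in> Bij F \<Longrightarrow> x \<in> F \<Longrightarrow> \<sigma> x \<in> F"
  using Bij_imp_funcset by auto

lemma Bij_eqI: "\<sigma> \<in> Bij F \<Longrightarrow> \<tau> \<in> Bij F \<Longrightarrow> (\<And>x. x \<in> F \<Longrightarrow> \<sigma> x = \<tau> x) \<Longrightarrow> \<sigma> = \<tau>"
  by (rule extensionalityI[of _ F]) (auto simp: Bij_imp_extensional)

text \<open>The map \<open>\<lambda>x. \<sigma> (\<tau> x)\<close> for automorphisms \<open>\<sigma>\<close> and \<open>\<tau>\<close> of \<open>F\<close> need not be extensional; this predicate covers
  automorphisms and such composites alike.\<close>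

definition differential_hom :: "('a::field \<Rightarrow> 'a) \<Rightarrow> 'a set \<Rightarrow> ('a \<Rightarrow> 'a) \<Rightarrow> bool" where
  "differential_hom D F \<sigma> \<longleftrightarrow>
     (\<forall>x\<in>F. \<forall>y\<in>F. \<sigma> (x + y) = \<sigma> x + \<sigma> y \<and> \<sigma> (x * y) = \<sigma> x * \<sigma> y) \<and>
     (\<forall>x\<in>F. \<sigma> (D x) = D (\<sigma> x)) \<and> \<sigma> 1 = 1"

lemma differential_homD:
  assumes "differential_hom D F \<sigma>" "diff_subfield D F"
  shows "x \<in> F \<Longrightarrow> y \<in> F \<Longrightarrow> \<sigma> (x + y) = \<sigma> x + \<sigma> y"
    and "x \<in> F \<Longrightarrow> y \<in> F \<Longrightarrow> \<sigma> (x * y) = \<sigma> x * \<sigma> y"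
    and "x \<in> F \<Longrightarrow> \<sigma> (D x) = D (\<sigma> x)"
    and "\<sigma> 1 = 1" and "\<sigma> 0 = 0"
    and "x \<in> F \<Longrightarrow> y \<in> F \<Longrightarrow> \<sigma> (x - y) = \<sigma> x - \<sigma> y"
    and "x \<in> F \<Longrightarrow> \<sigma> (inverse x) = inverse (\<sigma> x)"
proof -
  show add: "\<sigma> (x + y) = \<sigma> x + \<sigma> y" and mult: "\<sigma> (x * y) = \<sigma> x * \<sigma> y"
    if "x \<in> F" "y \<in> F" for x y
    using assms(1) that by (auto simp: differential_hom_def)
  show "\<sigma> (D x) = D (\<sigma> x)" if "x \<in> F"
    using assms(1) that by (auto simp: differential_hom_def)
  show one: "\<sigma> 1 = 1"
    using assms(1) by (auto simp: differential_hom_def)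
  show zero: "\<sigma> 0 = 0"
    using add[OF diff_subfield_0[OF assms(2)] diff_subfield_0[OF assms(2)]]
    by (metis add_0 add_cancel_right_right)
  show "\<sigma> (x - y) = \<sigma> x - \<sigma> y" if "x \<in> F" "y \<in> F"
    using add[of "x - y" y] that diff_subfieldD(2)[OF assms(2)] by (simp add: algebra_simps)
  show "\<sigma> (inverse x) = inverse (\<sigma> x)" if "x \<in> F"
  proof (cases "x = 0")
    case False
    then have "\<sigma> x * \<sigma> (inverse x) = 1"
      using mult[of x "inverse x"] that diff_subfieldD(4)[OF assms(2)] one by simp
    then show ?thesis
      by (simp add: inverse_unique)
  qed (use zero in simp)
qed

lemma differential_hom_sum:
  assumes "differential_hom D F \<sigma>" "diff_subfield D F" "\<And>i. i \<in> A \<Longrightarrow> f i \<in> F"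
  shows "\<sigma> (sum f A) = (\<Sum>i\<in>A. \<sigma> (f i))"
  using assms(3)
  by (induction A rule: infinite_finite_induct)
     (auto simp: differential_homD[OF assms(1,2)] diff_subfield_sum[OF assms(2)])

text \<open>Identities between automorphisms, such as commutation, only have to be checked on generators.\<close>

lemma diff_subfield_equalizer:
  assumes "differential_hom D F \<sigma>" "differential_hom D F \<tau>" "diff_subfield D F"
  shows "diff_subfield D {x \<in> F. \<sigma> x = \<tau> x}"
  unfolding diff_subfield_def
  by (auto simp: differential_homD[OF assms(1,3)] differential_homD[OF assms(2,3)]
      diff_subfieldD[OF assms(3)])

lemma diff_subfield_preimage:
  assumes "differential_hom D F \<sigma>" "diff_subfield D F" "diff_subfield D E"
  shows "diff_subfield D {x \<in> F. \<sigma> x \<in> E}"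
  unfolding diff_subfield_def
  by (auto simp: differential_homD[OF assms(1,2)] diff_subfieldD[OF assms(2)] diff_subfieldD[OF assms(3)])

lemma galois_hom: "\<sigma> \<in> galois D K F \<Longrightarrow> diff_subfield D K \<Longrightarrow> differential_hom D F \<sigma>"
  unfolding galois_def differential_hom_def by (auto simp: diff_subfieldD(1))

lemma galois_Bij: "\<sigma> \<in> galois D K F \<Longrightarrow> \<sigma> \<in> Bij F"
  by (simp add: galois_def)

lemma galois_fixes: "\<sigma> \<in> galois D K F \<Longrightarrow> x \<in> K \<Longrightarrow> \<sigma> x = x"
  by (simp add: galois_def)

lemma galois_hom_compose:
  assumes "\<sigma> \<in> galois D K F" "\<tau> \<in> galois D K F" "diff_subfield D K"
  shows "differential_hom D F (\<lambda>x. \<sigma> (\<tau> x))"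
  using assms unfolding galois_def differential_hom_def
  by (auto simp: diff_subfieldD(1) Bij_image)

text \<open>The Galois group is treated as a subgroup of the group of bijections of \<open>F\<close>, whose multiplication it
  shares.\<close>

lemma galois_subgroup:
  assumes F: "diff_subfield D F" and KF: "K \<subseteq> F"
  shows "subgroup (galois D K F) (BijGroup F)"
proof (rule subgroup.intro)
  show "galois D K F \<subseteq> carrier (BijGroup F)"
    by (auto simp: galois_def carrier_BijGroup)
  show "\<one>\<^bsub>BijGroup F\<^esub> \<in> galois D K F"
    using KF by (auto simp: galois_def one_BijGroup id_Bij diff_subfield_closed[OF F])
next
  fix \<sigma> \<tau> assume st: "\<sigma> \<in> galois D K F" "\<tau> \<in> galois D K F"
  note * = st[THEN galois_Bij]
  have "compose F \<sigma> \<tau> \<in> galois D K F"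
    using st KF unfolding galois_def
    by (auto simp: compose_Bij compose_eq diff_subfield_closed[OF F] Bij_image subset_iff)
  then show "\<sigma> \<otimes>\<^bsub>BijGroup F\<^esub> \<tau> \<in> galois D K F"
    by (simp add: mult_BijGroup *)
next
  fix \<sigma> assume s: "\<sigma> \<in> galois D K F"
  note bij = galois_Bij[OF s]
  define \<rho> where "\<rho> = inv_into F \<sigma>"
  have in_F: "\<rho> x \<in> F" and right: "\<sigma> (\<rho> x) = x" if "x \<in> F" for x
    using bij that by (auto simp: Bij_def bij_betw_def \<rho>_def inv_into_into f_inv_into_f)
  have left: "\<rho> (\<sigma> x) = x" if "x \<in> F" for x
    using bij that by (auto simp: Bij_def bij_betw_def \<rho>_def)
  have eq: "\<rho> y = x" if "x \<in> F" "\<sigma> x = y" for x y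
    using left that by auto
  have "restrict \<rho> F \<in> galois D K F"
    unfolding galois_def
  proof (intro CollectI conjI ballI)
    show "restrict \<rho> F \<in> Bij F"
      using restrict_inv_into_Bij[OF bij] by (simp add: \<rho>_def)
    fix x assume x: "x \<in> F"
    show "restrict \<rho> F (D x) = D (restrict \<rho> F x)"
      using x s by (simp add: diff_subfield_closed[OF F])
        (rule eq, auto simp: galois_def in_F right diff_subfield_closed[OF F])
    fix y assume y: "y \<in> F"
    show "restrict \<rho> F (x + y) = restrict \<rho> F x + restrict \<rho> F y"
      using x y s by (simp add: diff_subfield_closed[OF F])
        (rule eq, auto simp: galois_def in_F right diff_subfield_closed[OF F])
    show "restrict \<rho> F (x * y) = restrict \<rho> F x * restrict \<rho> F y"
      using x y s by (simp add: diff_subfield_closed[OF F])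
        (rule eq, auto simp: galois_def in_F right diff_subfield_closed[OF F])
  next
    fix x assume "x \<in> K"
    then show "restrict \<rho> F x = x"
      using eq[of x x] KF galois_fixes[OF s] by auto
  qed
  then show "inv\<^bsub>BijGroup F\<^esub> \<sigma> \<in> galois D K F"
    by (simp add: inv_BijGroup[OF bij] \<rho>_def)
qed

text \<open>A fundamental matrix that need not generate the extension under consideration.\<close>

definition solution_matrix :: "('a::field \<Rightarrow> 'a) \<Rightarrow> 'a set \<Rightarrow> nat \<Rightarrow> 'a mat \<Rightarrow> bool" where
  "solution_matrix D K m Y \<longleftrightarrow> Y \<in> carrier_mat m m \<and> invertible_mat Y \<and>
     (\<exists>B\<in>carrier_mat m m. elements_mat B \<subseteq> K \<and> map_mat D Y = B * Y)"

lemma fundamental_matrix_iff: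
  "fundamental_matrix D K F m Y \<longleftrightarrow> solution_matrix D K m Y \<and> F = adjoin D K (elements_mat Y)"
  by (auto simp: fundamental_matrix_def solution_matrix_def)

lemma fundamental_matrix_elements: "fundamental_matrix D K F m Y \<Longrightarrow> elements_mat Y \<subseteq> F"
  using adjoin_superset(2)[of "elements_mat Y" D K] by (auto simp: fundamental_matrix_def)

lemma galois_map_mult:
  assumes hom: "differential_hom D F \<sigma>" and F: "diff_subfield D F"
    and A: "A \<in> carrier_mat m n" "elements_mat A \<subseteq> F" and B: "B \<in> carrier_mat n k" "elements_mat B \<subseteq> F"
  shows "map_mat \<sigma> (A * B) = map_mat \<sigma> A * map_mat \<sigma> B"
proof (rule eq_matI)
  fix i j assume "i < dim_row (map_mat \<sigma> A * map_mat \<sigma> B)" "j < dim_col (map_mat \<sigma> A * map_mat \<sigma> B)"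
  then have ij: "i < m" "j < k" using A B by auto
  have el: "A $$ (i, l) \<in> F" "B $$ (l, j) \<in> F" if "l < n" for l
    using A(2) B(2) that ij unfolding elements_mat_subset_iff[OF A(1)] elements_mat_subset_iff[OF B(1)]
    by auto
  have mA: "map_mat \<sigma> A \<in> carrier_mat m n" and mB: "map_mat \<sigma> B \<in> carrier_mat n k"
    using A(1) B(1) by auto
  have "map_mat \<sigma> (A * B) $$ (i, j) = \<sigma> ((A * B) $$ (i, j))"
    using ij A(1) B(1) by (subst index_map_mat) auto
  also have "\<dots> = (\<Sum>l<n. \<sigma> (A $$ (i, l) * B $$ (l, j)))"
    unfolding index_mult_mat_sum[OF A(1) B(1) ij]
    by (rule differential_hom_sum[OF hom F]) (auto intro: el diff_subfieldD(3)[OF F])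
  also have "\<dots> = (\<Sum>l<n. map_mat \<sigma> A $$ (i, l) * map_mat \<sigma> B $$ (l, j))"
    using A(1) B(1) ij el by (intro sum.cong) (auto simp: differential_homD(2)[OF hom F])
  also have "\<dots> = (map_mat \<sigma> A * map_mat \<sigma> B) $$ (i, j)"
    by (rule index_mult_mat_sum[OF mA mB ij, symmetric])
  finally show "map_mat \<sigma> (A * B) $$ (i, j) = (map_mat \<sigma> A * map_mat \<sigma> B) $$ (i, j)" .
qed (use A B in auto)

lemma map_mat_ident_on: "elements_mat A \<subseteq> K \<Longrightarrow> (\<And>x. x \<in> K \<Longrightarrow> \<sigma> x = \<tau> x) \<Longrightarrow> map_mat \<sigma> A = map_mat \<tau> A"
  by (rule eq_matI) (auto simp: elements_mat_subset_iff[of A "dim_row A" "dim_col A"])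

lemma map_mat_ident: "map_mat (\<lambda>x. x) A = A"
  by (rule eq_matI) auto

context differential_field
begin

lemma iota_mat_mult:
  "A \<in> carrier_mat m n \<Longrightarrow> B \<in> carrier_mat n k \<Longrightarrow> map_mat \<iota> (A * B) = map_mat \<iota> A * map_mat \<iota> B"
  by (rule \<iota>.mat_hom_mult)

text \<open>The image of a fundamental matrix under an automorphism over \<open>K\<close> solves the same linear system.\<close>

lemma galois_matrix_exists:
  assumes K: "diff_subfield D K" and F: "diff_subfield D F" and KF: "K \<subseteq> F"
    and s: "\<sigma> \<in> galois D K F" and Y: "solution_matrix D K m Y" and el: "elements_mat Y \<subseteq> F"
  shows "\<exists>C\<in>carrier_mat m m. map_mat \<sigma> Y = Y * map_mat \<iota> C"
proof -
  obtain B where Y': "Y \<in> carrier_mat m m" "invertible_mat Y" and B: "B \<in> carrier_mat m m"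
    "elements_mat B \<subseteq> K" "map_mat D Y = B * Y"
    using Y unfolding solution_matrix_def by blast
  note hom = galois_hom[OF s K]
  have "map_mat D (map_mat \<sigma> Y) = map_mat \<sigma> (map_mat D Y)"
    using el Y'(1) by (intro eq_matI) (auto simp: elements_mat_subset_iff[OF Y'(1)] differential_homD(3)[OF hom F])
  also have "\<dots> = map_mat \<sigma> B * map_mat \<sigma> Y"
    unfolding B(3) using B(2) KF by (intro galois_map_mult[OF hom F B(1) _ Y'(1) el]) auto
  also have "map_mat \<sigma> B = B"
    using map_mat_ident_on[OF B(2), of \<sigma> "\<lambda>x. x"] galois_fixes[OF s] by (simp add: map_mat_ident)
  finally show ?thesis
    using solutions_of_linear_system[OF Y' B(1,3), of "map_mat \<sigma> Y" m] Y'(1) by auto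
qed

lemma galois_matrix_unique:
  assumes Y: "solution_matrix D K m Y" and C: "C \<in> carrier_mat m n" "C' \<in> carrier_mat m n"
    and eq: "Y * map_mat \<iota> C = Y * map_mat \<iota> C'"
  shows "C = C'"
proof -
  obtain V where V: "V \<in> carrier_mat m m" "V * Y = 1\<^sub>m m"
    using Y invertible_mat_obtain_inverse unfolding solution_matrix_def by metis
  have Y': "Y \<in> carrier_mat m m"
    using Y by (simp add: solution_matrix_def)
  have cancel: "V * (Y * map_mat \<iota> A) = map_mat \<iota> A" if "A \<in> carrier_mat m n" for A
    using that V Y' by (simp add: assoc_mult_mat[of V m m Y m "map_mat \<iota> A" n, symmetric])
  have "map_mat \<iota> C = V * (Y * map_mat \<iota> C')"
    unfolding eq[symmetric] by (rule cancel[OF C(1), symmetric])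
  also have "\<dots> = map_mat \<iota> C'"
    by (rule cancel[OF C(2)])
  finally show ?thesis
    by (rule \<iota>.mat_hom_inj)
qed

text \<open>Normality: since \<open>\<sigma> Y = Y C\<close>, automorphisms of a larger field preserve a Picard-Vessiot extension.\<close>

lemma galois_preserves_picard_vessiot:
  assumes F1: "picard_vessiot D K F1" and F2: "diff_subfield D F2" and sub: "F1 \<subseteq> F2"
    and range: "range \<iota> \<subseteq> K" and s: "\<sigma> \<in> galois D K F2" and x: "x \<in> F1"
  shows "\<sigma> x \<in> F1"
proof -
  have K: "diff_subfield D K" and dF1: "diff_subfield D F1" and KF1: "K \<subseteq> F1"
    using F1 by (auto simp: picard_vessiot_def)
  obtain m Y where Y: "solution_matrix D K m Y" "F1 = adjoin D K (elements_mat Y)" "elements_mat Y \<subseteq> F1"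
    using F1 fundamental_matrix_elements unfolding picard_vessiot_def fundamental_matrix_iff by metis
  have Yc: "Y \<in> carrier_mat m m"
    using Y(1) by (simp add: solution_matrix_def)
  have Yel: "Y $$ (i, j) \<in> F1" if "i < m" "j < m" for i j
    using Y(3) that unfolding elements_mat_subset_iff[OF Yc] by blast
  obtain C where C: "C \<in> carrier_mat m m" "map_mat \<sigma> Y = Y * map_mat \<iota> C"
    using galois_matrix_exists[OF K F2 _ s Y(1)] KF1 sub Y(3) by blast
  let ?E = "{x \<in> F2. \<sigma> x \<in> F1}"
  have "\<sigma> (Y $$ (i, j)) \<in> F1" if "i < m" "j < m" for i j
  proof -
    have "\<sigma> (Y $$ (i, j)) = (Y * map_mat \<iota> C) $$ (i, j)"
      using that Yc arg_cong[OF C(2), of "\<lambda>A. A $$ (i, j)"] by auto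
    also have "\<dots> = (\<Sum>l<m. Y $$ (i, l) * \<iota> (C $$ (l, j)))"
      using C(1) that by (subst index_mult_mat_sum[OF Yc]) auto
    also have "\<dots> \<in> F1"
      using Yel that subsetD[OF KF1 subsetD[OF range rangeI]]
      by (intro diff_subfield_sum[OF dF1] diff_subfieldD(3)[OF dF1]) auto
    finally show ?thesis .
  qed
  then have "F1 \<subseteq> ?E"
    unfolding Y(2)
    by (intro adjoin_least diff_subfield_preimage[OF galois_hom[OF s K] F2 dF1, unfolded Y(2)])
       (use KF1 sub Yel Y(2) in \<open>auto simp: elements_mat_subset_iff[OF Yc] galois_fixes[OF s]\<close>)
  then show ?thesis using x by blast
qed

end


subsection \<open>The Zariski topology and the identity component\<close>

lemma polynomial_on_matrices_sum:
  "(\<And>i. i \<in> A \<Longrightarrow> P i \<in> polynomial_on_matrices m) \<Longrightarrow> (\<lambda>C. \<Sum>i\<in>A. P i C) \<in> polynomial_on_matrices m"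
  by (induction A rule: infinite_finite_induct)
     (auto intro: polynomial_on_matrices.intros)

lemma polynomial_on_matrices_substitution:
  assumes "P \<in> polynomial_on_matrices m" "\<And>i j. i < m \<Longrightarrow> j < m \<Longrightarrow> Q i j \<in> polynomial_on_matrices n"
  shows "\<exists>R\<in>polynomial_on_matrices n. \<forall>C. \<forall>A\<in>carrier_mat m m.
           (\<forall>i<m. \<forall>j<m. A $$ (i, j) = Q i j C) \<longrightarrow> P A = R C"
  using assms(1)
proof (induction rule: polynomial_on_matrices.induct)
  case (const c)
  show ?case
    by (rule bexI[of _ "\<lambda>_. c"]) (auto intro: polynomial_on_matrices.const)
next
  case (entry i j)
  then show ?case
    by (intro bexI[of _ "Q i j"]) (auto intro: assms(2))
next
  case (add P P')
  then obtain R R' where "R \<in> polynomial_on_matrices n" "R' \<in> polynomial_on_matrices n"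
    "\<forall>C. \<forall>A\<in>carrier_mat m m. (\<forall>i<m. \<forall>j<m. A $$ (i, j) = Q i j C) \<longrightarrow> P A = R C"
    "\<forall>C. \<forall>A\<in>carrier_mat m m. (\<forall>i<m. \<forall>j<m. A $$ (i, j) = Q i j C) \<longrightarrow> P' A = R' C"
    by blast
  then show ?case
    by (intro bexI[of _ "\<lambda>C. R C + R' C"] allI ballI impI arg_cong2[where f = "(+)"])
       (blast intro: polynomial_on_matrices.add)+
next
  case (mult P P')
  then obtain R R' where "R \<in> polynomial_on_matrices n" "R' \<in> polynomial_on_matrices n"
    "\<forall>C. \<forall>A\<in>carrier_mat m m. (\<forall>i<m. \<forall>j<m. A $$ (i, j) = Q i j C) \<longrightarrow> P A = R C"
    "\<forall>C. \<forall>A\<in>carrier_mat m m. (\<forall>i<m. \<forall>j<m. A $$ (i, j) = Q i j C) \<longrightarrow> P' A = R' C"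
    by blast
  then show ?case
    by (intro bexI[of _ "\<lambda>C. R C * R' C"] allI ballI impI arg_cong2[where f = "(*)"])
       (blast intro: polynomial_on_matrices.mult)+
qed

lemma polynomial_left_translation:
  assumes "P \<in> polynomial_on_matrices m" "A \<in> carrier_mat m m"
  shows "\<exists>R\<in>polynomial_on_matrices m. \<forall>C\<in>carrier_mat m m. P (A * C) = R C"
proof -
  let ?Q = "\<lambda>i j C. \<Sum>l<m. A $$ (i, l) * C $$ (l, j)"
  have "?Q i j \<in> polynomial_on_matrices m" if "i < m" "j < m" for i j
    using that
    by (intro polynomial_on_matrices_sum polynomial_on_matrices.mult polynomial_on_matrices.const
        polynomial_on_matrices.entry) auto
  from polynomial_on_matrices_substitution[OF assms(1), of ?Q, OF this]
  obtain R where R: "R \<in> polynomial_on_matrices m" "\<And>C B. B \<in> carrier_mat m m \<Longrightarrow>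
     (\<forall>i<m. \<forall>j<m. B $$ (i, j) = ?Q i j C) \<Longrightarrow> P B = R C"
    by blast
  have "P (A * C) = R C" if "C \<in> carrier_mat m m" for C
    using assms(2) that by (intro R(2)) (auto simp: index_mult_mat_sum[OF assms(2) that] simp del: index_mult_mat)
  then show ?thesis using R(1) by blast
qed

lemma polynomial_upper_left_block:
  assumes "P \<in> polynomial_on_matrices m"
  shows "\<exists>R\<in>polynomial_on_matrices (m + n). \<forall>A\<in>carrier_mat m m. \<forall>B\<in>carrier_mat n n.
           P A = R (four_block_mat A (0\<^sub>m m n) (0\<^sub>m n m) B)"
proof -
  let ?Q = "\<lambda>i j C. C $$ (i, j)"
  have "?Q i j \<in> polynomial_on_matrices (m + n)" if "i < m" "j < m" for i j
    using that by (intro polynomial_on_matrices.entry) auto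
  from polynomial_on_matrices_substitution[OF assms(1), of ?Q, OF this]
  obtain R where R: "R \<in> polynomial_on_matrices (m + n)" "\<And>C B. B \<in> carrier_mat m m \<Longrightarrow>
     (\<forall>i<m. \<forall>j<m. B $$ (i, j) = ?Q i j C) \<Longrightarrow> P B = R C"
    by blast
  have "P A = R (four_block_mat A (0\<^sub>m m n) (0\<^sub>m n m) B)"
    if "A \<in> carrier_mat m m" "B \<in> carrier_mat n n" for A B
    using that by (intro R(2)) auto
  then show ?thesis using R(1) by blast
qed

lemma four_block_diag_mult:
  assumes "A \<in> carrier_mat m m" "A' \<in> carrier_mat m m" "B \<in> carrier_mat n n" "B' \<in> carrier_mat n n"
  shows "four_block_mat A (0\<^sub>m m n) (0\<^sub>m n m) B * four_block_mat A' (0\<^sub>m m n) (0\<^sub>m n m) B'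
       = four_block_mat (A * A') (0\<^sub>m m n) (0\<^sub>m n m) (B * B' :: 'a::semiring_1 mat)"
  using assms
  by (subst mult_four_block_mat[of _ m m _ n _ n _ _ m _ n]) (auto intro!: arg_cong4[of _ _ _ _ _ _ _ _ four_block_mat])

lemma map_four_block_diag:
  assumes "A \<in> carrier_mat m m" "B \<in> carrier_mat n n" "f 0 = 0"
  shows "map_mat f (four_block_mat A (0\<^sub>m m n) (0\<^sub>m n m) B) = four_block_mat (map_mat f A) (0\<^sub>m m n) (0\<^sub>m n m) (map_mat f B)"
  by (rule eq_matI) (use assms in auto)

lemma elements_four_block_diag:
  assumes "A \<in> carrier_mat m m" "B \<in> carrier_mat n n" "0 \<in> E"
  shows "elements_mat (four_block_mat A (0\<^sub>m m n) (0\<^sub>m n m) B) \<subseteq> E \<longleftrightarrow> elements_mat A \<subseteq> E \<and> elements_mat B \<subseteq> E"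
    (is "elements_mat ?M \<subseteq> E \<longleftrightarrow> _")
proof -
  have M: "?M \<in> carrier_mat (m + n) (m + n)"
    using assms by simp
  show ?thesis
    unfolding elements_mat_subset_iff[OF M] elements_mat_subset_iff[OF assms(1)]
      elements_mat_subset_iff[OF assms(2)]
  proof safe
    fix i j
    assume all: "\<forall>i<m + n. \<forall>j<m + n. ?M $$ (i, j) \<in> E"
    show "A $$ (i, j) \<in> E" if "i < m" "j < m"
      using all[rule_format, of i j] that assms by auto
    show "B $$ (i, j) \<in> E" if "i < n" "j < n"
      using all[rule_format, of "m + i" "m + j"] that assms by auto
  next
    fix i j
    assume "\<forall>i<m. \<forall>j<m. A $$ (i, j) \<in> E" "\<forall>i<n. \<forall>j<n. B $$ (i, j) \<in> E" "i < m + n" "j < m + n"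
    then show "?M $$ (i, j) \<in> E"
      using assms by auto
  qed
qed

text \<open>Used to compare the Zariski topologies of two extensions: the block diagonal matrix is a fundamental matrix
  of the larger extension that displays the one of the smaller extension.\<close>

lemma (in differential_field) four_block_diag_solution_matrix:
  assumes K: "diff_subfield D K" and Y: "solution_matrix D K m Y" and Y': "solution_matrix D K n Y'"
  shows "solution_matrix D K (m + n) (four_block_mat Y (0\<^sub>m m n) (0\<^sub>m n m) Y')"
proof -
  let ?block = "\<lambda>A B. four_block_mat A (0\<^sub>m m n) (0\<^sub>m n m) B :: 'a mat"
  obtain B where B: "Y \<in> carrier_mat m m" "invertible_mat Y" "B \<in> carrier_mat m m"
    "elements_mat B \<subseteq> K" "map_mat D Y = B * Y"
    using Y unfolding solution_matrix_def by blast
  obtain B' where B': "Y' \<in> carrier_mat n n" "invertible_mat Y'" "B' \<in> carrier_mat n n"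
    "elements_mat B' \<subseteq> K" "map_mat D Y' = B' * Y'"
    using Y' unfolding solution_matrix_def by blast
  obtain V V' where V: "V \<in> carrier_mat m m" "V * Y = 1\<^sub>m m" "Y * V = 1\<^sub>m m"
    and V': "V' \<in> carrier_mat n n" "V' * Y' = 1\<^sub>m n" "Y' * V' = 1\<^sub>m n"
    using invertible_mat_obtain_inverse[OF B(2,1)] invertible_mat_obtain_inverse[OF B'(2,1)] by metis
  have "?block V V' * ?block Y Y' = 1\<^sub>m (m + n)" "?block Y Y' * ?block V V' = 1\<^sub>m (m + n)"
    by (simp_all add: four_block_diag_mult B(1) B'(1) V V' four_block_one_mat)
  then have "invertible_mat (?block Y Y')"
    using B(1) B'(1) V(1) V'(1) by (intro invertible_matI[of _ "m + n" "?block V V'"]) auto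
  moreover have "map_mat D (?block Y Y') = ?block B B' * ?block Y Y'"
    by (simp add: map_four_block_diag B(1,5) B'(1,5) four_block_diag_mult B(3) B'(3))
  moreover have "elements_mat (?block B B') \<subseteq> K"
    using elements_four_block_diag[OF B(3) B'(3)] B(4) B'(4) diff_subfield_0[OF K] by blast
  ultimately show ?thesis
    unfolding solution_matrix_def using B(1,3) B'(1,3) by (intro conjI bexI[of _ "?block B B'"]) auto
qed

definition galois_basic_open ::
    "('a::field \<Rightarrow> 'a) \<Rightarrow> (complex \<Rightarrow> 'a) \<Rightarrow> 'a set \<Rightarrow> 'a set \<Rightarrow> nat \<Rightarrow> 'a mat \<Rightarrow> (complex mat \<Rightarrow> complex) \<Rightarrow> ('a \<Rightarrow> 'a) set" where
  "galois_basic_open D \<iota> K F m Y P = {\<sigma> \<in> galois D K F.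
     \<exists>C\<in>carrier_mat m m. map_mat \<sigma> Y = Y * map_mat \<iota> C \<and> P C \<noteq> 0}"

lemma zariski_gal_eq:
  "zariski_gal D \<iota> K F = topology_generated_by
     {galois_basic_open D \<iota> K F m Y P | m Y P. fundamental_matrix D K F m Y \<and> P \<in> polynomial_on_matrices m}"
  by (simp add: zariski_gal_def galois_basic_open_def)

lemma openin_galois_basic_open:
  "fundamental_matrix D K F m Y \<Longrightarrow> P \<in> polynomial_on_matrices m \<Longrightarrow>
     openin (zariski_gal D \<iota> K F) (galois_basic_open D \<iota> K F m Y P)"
  unfolding zariski_gal_eq by (rule topology_generated_by_Basis) blast

definition galois_component ::
    "('a::field \<Rightarrow> 'a) \<Rightarrow> (complex \<Rightarrow> 'a) \<Rightarrow> 'a set \<Rightarrow> 'a set \<Rightarrow> ('a \<Rightarrow> 'a) set" where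
  "galois_component D \<iota> K F = connected_component_of_set (zariski_gal D \<iota> K F) (\<lambda>x\<in>F. x)"

lemma identity_component_eq:
  "identity_component D \<iota> K F = BijGroup F\<lparr>carrier := galois_component D \<iota> K F\<rparr>"
  by (simp add: identity_component_def diff_gal_def galois_component_def BijGroup_def)

locale picard_vessiot_extension = differential_field D \<iota>
  for D :: "'a::field_char_0 \<Rightarrow> 'a" and \<iota> :: "complex \<Rightarrow> 'a" +
  fixes K F :: "'a set"
  assumes pv: "picard_vessiot D K F" and range: "range \<iota> \<subseteq> K"
begin

lemma K: "diff_subfield D K" and F: "diff_subfield D F" and KF: "K \<subseteq> F"
  using pv by (auto simp: picard_vessiot_def)

lemma fundamental_matrix_exists: "\<exists>m Y. fundamental_matrix D K F m Y"
  using pv by (auto simp: picard_vessiot_def)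

lemmas subgroup_galois = galois_subgroup[OF F KF]

lemma topspace_zariski: "topspace (zariski_gal D \<iota> K F) = galois D K F"
proof
  show "topspace (zariski_gal D \<iota> K F) \<subseteq> galois D K F"
    unfolding zariski_gal_eq by (auto simp: galois_basic_open_def)
  obtain m Y where Y: "fundamental_matrix D K F m Y"
    using fundamental_matrix_exists by blast
  have "galois D K F \<subseteq> galois_basic_open D \<iota> K F m Y (\<lambda>_. 1)"
    using galois_matrix_exists[OF K F KF _ _ fundamental_matrix_elements[OF Y]] Y
    by (auto simp: galois_basic_open_def fundamental_matrix_iff)
  moreover have "galois_basic_open D \<iota> K F m Y (\<lambda>_. 1) \<subseteq> topspace (zariski_gal D \<iota> K F)"
    by (rule openin_subset[OF openin_galois_basic_open[OF Y]]) (rule polynomial_on_matrices.const)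
  ultimately show "galois D K F \<subseteq> topspace (zariski_gal D \<iota> K F)"
    by blast
qed

lemma continuous_map_zariskiI:
  assumes "\<And>\<sigma>. \<sigma> \<in> topspace T \<Longrightarrow> f \<sigma> \<in> galois D K F"
    "\<And>m Y P. fundamental_matrix D K F m Y \<Longrightarrow> P \<in> polynomial_on_matrices m \<Longrightarrow>
       openin T (f -` galois_basic_open D \<iota> K F m Y P \<inter> topspace T)"
  shows "continuous_map T (zariski_gal D \<iota> K F) f"
  unfolding zariski_gal_eq
proof (rule continuous_on_generated_topo)
  show "f ` topspace T \<subseteq> \<Union> {galois_basic_open D \<iota> K F m Y P | m Y P.
      fundamental_matrix D K F m Y \<and> P \<in> polynomial_on_matrices m}"
    using assms(1) topspace_zariski unfolding zariski_gal_eq topology_generated_by_topspace by blast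
qed (use assms(2) in blast)

text \<open>\<open>\<tau> Y = Y A\<close> and \<open>\<sigma> Y = Y C\<close> give \<open>\<tau> (\<sigma> Y) = Y A C\<close>, and \<open>P (A C)\<close> is a polynomial in \<open>C\<close>.\<close>

lemma continuous_left_translation:
  assumes t: "\<tau> \<in> galois D K F"
  shows "continuous_map (zariski_gal D \<iota> K F) (zariski_gal D \<iota> K F) (\<lambda>\<sigma>. \<tau> \<otimes>\<^bsub>BijGroup F\<^esub> \<sigma>)"
proof (rule continuous_map_zariskiI)
  show "\<tau> \<otimes>\<^bsub>BijGroup F\<^esub> \<sigma> \<in> galois D K F" if "\<sigma> \<in> topspace (zariski_gal D \<iota> K F)" for \<sigma>
    using that t subgroup.m_closed[OF subgroup_galois] by (simp add: topspace_zariski)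
next
  fix m Y P assume fund: "fundamental_matrix D K F m Y" and P: "P \<in> polynomial_on_matrices m"
  have Y: "solution_matrix D K m Y"
    using fund by (simp add: fundamental_matrix_iff)
  have el: "elements_mat Y \<subseteq> F"
    by (rule fundamental_matrix_elements[OF fund])
  have Yc: "Y \<in> carrier_mat m m"
    using Y by (simp add: solution_matrix_def)
  obtain A where A: "A \<in> carrier_mat m m" "map_mat \<tau> Y = Y * map_mat \<iota> A"
    using galois_matrix_exists[OF K F KF t Y el] by blast
  obtain R where R: "R \<in> polynomial_on_matrices m" "\<And>C. C \<in> carrier_mat m m \<Longrightarrow> P (A * C) = R C"
    using polynomial_left_translation[OF P A(1)] by blast
  have prod: "map_mat (\<tau> \<otimes>\<^bsub>BijGroup F\<^esub> \<sigma>) Y = Y * map_mat \<iota> (A * C)"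
    if s: "\<sigma> \<in> galois D K F" and C: "C \<in> carrier_mat m m" "map_mat \<sigma> Y = Y * map_mat \<iota> C" for \<sigma> C
  proof -
    have iC: "elements_mat (map_mat \<iota> C) \<subseteq> K" "map_mat \<iota> C \<in> carrier_mat m m"
      using range C(1) by (auto simp: elements_mat_subset_iff[of _ m m])
    have "map_mat (\<tau> \<otimes>\<^bsub>BijGroup F\<^esub> \<sigma>) Y = map_mat \<tau> (map_mat \<sigma> Y)"
      using el s t by (intro eq_matI)
        (auto simp: mult_BijGroup galois_Bij compose_eq elements_mat_subset_iff[OF Yc] Yc[THEN carrier_matD(1)] Yc[THEN carrier_matD(2)])
    also have "\<dots> = map_mat \<tau> Y * map_mat \<tau> (map_mat \<iota> C)"
      unfolding C(2) using iC KF by (intro galois_map_mult[OF galois_hom[OF t K] F Yc el]) auto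
    also have "map_mat \<tau> (map_mat \<iota> C) = map_mat \<iota> C"
      using map_mat_ident_on[OF iC(1), of \<tau> "\<lambda>x. x"] galois_fixes[OF t] by (simp add: map_mat_ident)
    also have "map_mat \<tau> Y * map_mat \<iota> C = Y * map_mat \<iota> (A * C)"
      unfolding A(2) using Yc A(1) C(1) by (simp add: iota_mat_mult assoc_mult_mat[of Y m m "map_mat \<iota> A" m])
    finally show ?thesis .
  qed
  have "(\<lambda>\<sigma>. \<tau> \<otimes>\<^bsub>BijGroup F\<^esub> \<sigma>) -` galois_basic_open D \<iota> K F m Y P \<inter> galois D K F
      = galois_basic_open D \<iota> K F m Y R"
  proof (intro equalityI subsetI)
    fix \<sigma> assume "\<sigma> \<in> (\<lambda>\<sigma>. \<tau> \<otimes>\<^bsub>BijGroup F\<^esub> \<sigma>) -` galois_basic_open D \<iota> K F m Y P \<inter> galois D K F"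
    then obtain C' where s: "\<sigma> \<in> galois D K F" and C': "C' \<in> carrier_mat m m"
      "map_mat (\<tau> \<otimes>\<^bsub>BijGroup F\<^esub> \<sigma>) Y = Y * map_mat \<iota> C'" "P C' \<noteq> 0"
      by (auto simp: galois_basic_open_def)
    obtain C where C: "C \<in> carrier_mat m m" "map_mat \<sigma> Y = Y * map_mat \<iota> C"
      using galois_matrix_exists[OF K F KF s Y el] by blast
    have "C' = A * C"
      using prod[OF s C] C'(1,2) A(1) C(1) by (intro galois_matrix_unique[OF Y, of C' m]) auto
    then show "\<sigma> \<in> galois_basic_open D \<iota> K F m Y R"
      using s C C'(3) R(2) by (auto simp: galois_basic_open_def)
  next
    fix \<sigma> assume "\<sigma> \<in> galois_basic_open D \<iota> K F m Y R"
    then obtain C where s: "\<sigma> \<in> galois D K F" and C: "C \<in> carrier_mat m m"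
      "map_mat \<sigma> Y = Y * map_mat \<iota> C" "R C \<noteq> 0"
      by (auto simp: galois_basic_open_def)
    have "\<tau> \<otimes>\<^bsub>BijGroup F\<^esub> \<sigma> \<in> galois D K F"
      using s t subgroup.m_closed[OF subgroup_galois] by blast
    then show "\<sigma> \<in> (\<lambda>\<sigma>. \<tau> \<otimes>\<^bsub>BijGroup F\<^esub> \<sigma>) -` galois_basic_open D \<iota> K F m Y P \<inter> galois D K F"
      using s C R(2) A(1) prod[OF s C(1,2)] by (auto simp: galois_basic_open_def intro!: bexI[of _ "A * C"])
  qed
  then show "openin (zariski_gal D \<iota> K F) ((\<lambda>\<sigma>. \<tau> \<otimes>\<^bsub>BijGroup F\<^esub> \<sigma>) -` galois_basic_open D \<iota> K F m Y P
      \<inter> topspace (zariski_gal D \<iota> K F))"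
    using openin_galois_basic_open[OF fund R(1)] by (simp add: topspace_zariski)
qed

lemma component_subset: "galois_component D \<iota> K F \<subseteq> galois D K F"
  using connected_component_of_subset_topspace topspace_zariski unfolding galois_component_def by metis

lemma one_in_component: "(\<lambda>x\<in>F. x) \<in> galois_component D \<iota> K F"
  using subgroup.one_closed[OF subgroup_galois]
  by (simp add: galois_component_def connected_component_of_refl topspace_zariski one_BijGroup)

text \<open>The translate of the component by \<open>\<sigma>\<^sup>-\<^sup>1\<close> is connected and contains the identity \<open>\<sigma>\<^sup>-\<^sup>1 \<sigma>\<close>.\<close>

lemma component_left_translation:
  assumes s: "\<sigma> \<in> galois_component D \<iota> K F" and t: "\<tau> \<in> galois_component D \<iota> K F"
  shows "inv\<^bsub>BijGroup F\<^esub> \<sigma> \<otimes>\<^bsub>BijGroup F\<^esub> \<tau> \<in> galois_component D \<iota> K F"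
proof -
  interpret G: group "BijGroup F"
    by (rule group_BijGroup)
  let ?S = "galois_component D \<iota> K F"
  have sG: "\<sigma> \<in> galois D K F"
    using s component_subset by blast
  have "inv\<^bsub>BijGroup F\<^esub> \<sigma> \<in> galois D K F"
    using subgroup.m_inv_closed[OF subgroup_galois sG] .
  then have "connectedin (zariski_gal D \<iota> K F) ((\<lambda>\<tau>. inv\<^bsub>BijGroup F\<^esub> \<sigma> \<otimes>\<^bsub>BijGroup F\<^esub> \<tau>) ` ?S)"
    unfolding galois_component_def
    by (intro connectedin_continuous_map_image[OF continuous_left_translation]
        connectedin_connected_component_of)
  moreover have "(\<lambda>x\<in>F. x) \<in> (\<lambda>\<tau>. inv\<^bsub>BijGroup F\<^esub> \<sigma> \<otimes>\<^bsub>BijGroup F\<^esub> \<tau>) ` ?S"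
    using s G.l_inv[of \<sigma>] galois_Bij[OF sG]
    by (intro image_eqI[of _ _ \<sigma>]) (auto simp: carrier_BijGroup one_BijGroup)
  ultimately have "(\<lambda>\<tau>. inv\<^bsub>BijGroup F\<^esub> \<sigma> \<otimes>\<^bsub>BijGroup F\<^esub> \<tau>) ` ?S \<subseteq> ?S"
    unfolding galois_component_def by (rule connected_component_of_maximal)
  then show ?thesis using t by blast
qed

text \<open>Closure under \<open>\<sigma>\<^sup>-\<^sup>1 \<tau>\<close> is the subgroup criterion.\<close>

lemma component_subgroup: "subgroup (galois_component D \<iota> K F) (BijGroup F)"
proof -
  interpret G: group "BijGroup F"
    by (rule group_BijGroup)
  let ?S = "galois_component D \<iota> K F"
  have car: "?S \<subseteq> carrier (BijGroup F)"
    using component_subset subgroup.subset[OF subgroup_galois] by blast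
  have one: "\<one>\<^bsub>BijGroup F\<^esub> \<in> ?S"
    using one_in_component by (simp add: one_BijGroup)
  have inv: "inv\<^bsub>BijGroup F\<^esub> \<sigma> \<in> ?S" if "\<sigma> \<in> ?S" for \<sigma>
    using component_left_translation[OF that one] car that by auto
  have "\<sigma> \<otimes>\<^bsub>BijGroup F\<^esub> \<tau> \<in> ?S" if "\<sigma> \<in> ?S" "\<tau> \<in> ?S" for \<sigma> \<tau>
    using component_left_translation[OF inv[OF that(1)] that(2)] car that by auto
  with car one inv show ?thesis
    by (intro subgroup.intro) auto
qed

end

locale picard_vessiot_tower =
  big: picard_vessiot_extension D \<iota> K F2 + small: picard_vessiot_extension D \<iota> K F1
  for D :: "'a::field_char_0 \<Rightarrow> 'a" and \<iota> :: "complex \<Rightarrow> 'a" and K F1 F2 :: "'a set" +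
  assumes sub: "F1 \<subseteq> F2"
begin

lemma galois_preserves: "\<sigma> \<in> galois D K F2 \<Longrightarrow> x \<in> F1 \<Longrightarrow> \<sigma> x \<in> F1"
  by (rule big.galois_preserves_picard_vessiot[OF small.pv big.F sub small.range])

lemma restrict_in_galois:
  assumes s: "\<sigma> \<in> galois D K F2"
  shows "restrict \<sigma> F1 \<in> galois D K F1"
proof -
  let ?inv = "inv\<^bsub>BijGroup F2\<^esub> \<sigma>"
  have bij: "bij_betw \<sigma> F2 F2"
    using galois_Bij[OF s] by (simp add: Bij_def)
  have "?inv \<in> galois D K F2"
    by (rule subgroup.m_inv_closed[OF big.subgroup_galois s])
  then have inv: "inv_into F2 \<sigma> x \<in> F1" if "x \<in> F1" for x
    using galois_preserves[of ?inv x] that sub by (auto simp: inv_BijGroup[OF galois_Bij[OF s]])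
  have "bij_betw (restrict \<sigma> F1) F1 F1"
    unfolding bij_betw_def
  proof
    show "inj_on (restrict \<sigma> F1) F1"
      using bij sub by (auto simp: bij_betw_def inj_on_def)
    have "x \<in> \<sigma> ` F1" if "x \<in> F1" for x
      using inv[OF that] that sub bij by (intro image_eqI[of _ _ "inv_into F2 \<sigma> x"])
        (auto simp: bij_betw_def f_inv_into_f)
    then show "restrict \<sigma> F1 ` F1 = F1"
      using galois_preserves[OF s] by auto
  qed
  then have "restrict \<sigma> F1 \<in> Bij F1"
    by (simp add: Bij_def)
  then show ?thesis
    using s sub small.KF unfolding galois_def
    by (auto simp: diff_subfield_closed[OF small.F] subset_iff)
qed

text \<open>A basic open set of the smaller Galois group is given by a condition \<open>P C \<noteq> 0\<close> on the matrix of \<open>\<sigma>\<close> with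
  respect to some \<open>Y\<close>. Next to a fundamental matrix \<open>Y2\<close> of the larger extension, \<open>Y\<close> becomes the upper left
  block of another fundamental matrix of that extension, and the condition is a polynomial condition
  on the upper left block of the matrix of \<open>\<sigma>\<close>.\<close>

lemma continuous_restriction:
  "continuous_map (zariski_gal D \<iota> K F2) (zariski_gal D \<iota> K F1) (\<lambda>\<sigma>. restrict \<sigma> F1)"
proof (rule small.continuous_map_zariskiI)
  show "restrict \<sigma> F1 \<in> galois D K F1" if "\<sigma> \<in> topspace (zariski_gal D \<iota> K F2)" for \<sigma>
    using that restrict_in_galois by (simp add: big.topspace_zariski)
next
  fix m Y P assume fund: "fundamental_matrix D K F1 m Y" and P: "P \<in> polynomial_on_matrices m"
  have Y: "solution_matrix D K m Y"
    using fund by (simp add: fundamental_matrix_iff)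
  have el: "elements_mat Y \<subseteq> F1"
    by (rule fundamental_matrix_elements[OF fund])
  have Yc: "Y \<in> carrier_mat m m"
    using Y by (simp add: solution_matrix_def)
  obtain n Y2 where fund2: "fundamental_matrix D K F2 n Y2"
    using big.fundamental_matrix_exists by blast
  have Y2: "solution_matrix D K n Y2" and gen: "F2 = adjoin D K (elements_mat Y2)"
    using fund2 by (simp_all add: fundamental_matrix_iff)
  have el2: "elements_mat Y2 \<subseteq> F2"
    by (rule fundamental_matrix_elements[OF fund2])
  have Y2c: "Y2 \<in> carrier_mat n n"
    using Y2 by (simp add: solution_matrix_def)
  let ?block = "\<lambda>A B. four_block_mat A (0\<^sub>m m n) (0\<^sub>m n m) B"
  let ?Y = "?block Y Y2"
  have Y3: "solution_matrix D K (m + n) ?Y"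
    by (rule big.four_block_diag_solution_matrix[OF big.K Y Y2])
  have el3: "elements_mat ?Y \<subseteq> E \<longleftrightarrow> elements_mat Y \<subseteq> E \<and> elements_mat Y2 \<subseteq> E" if "diff_subfield D E" for E
    by (rule elements_four_block_diag[OF Yc Y2c diff_subfield_0[OF that]])
  have "F2 = adjoin D K (elements_mat ?Y)"
  proof
    show "F2 \<subseteq> adjoin D K (elements_mat ?Y)"
      unfolding gen
      using el3[OF diff_subfield_adjoin, of K "elements_mat ?Y"] adjoin_superset(2)[of "elements_mat ?Y" D K]
      by (intro adjoin_least[OF diff_subfield_adjoin adjoin_superset(1)]) blast
    show "adjoin D K (elements_mat ?Y) \<subseteq> F2"
      using el el2 sub by (intro adjoin_least[OF big.F big.KF]) (auto simp: el3[OF big.F])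
  qed
  then have fund3: "fundamental_matrix D K F2 (m + n) ?Y"
    using Y3 by (simp add: fundamental_matrix_iff)
  obtain R where R: "R \<in> polynomial_on_matrices (m + n)"
    "\<And>A B. A \<in> carrier_mat m m \<Longrightarrow> B \<in> carrier_mat n n \<Longrightarrow> P A = R (?block A B)"
    using polynomial_upper_left_block[OF P, of n] by blast
  have map_restrict: "map_mat (restrict \<sigma> F1) Y = map_mat \<sigma> Y" for \<sigma>
    by (rule map_mat_ident_on[OF el]) simp
  have block: "map_mat \<sigma> ?Y = ?Y * map_mat \<iota> (?block A B)"
    if s: "\<sigma> \<in> galois D K F2" and A: "A \<in> carrier_mat m m" "map_mat \<sigma> Y = Y * map_mat \<iota> A"
      and B: "B \<in> carrier_mat n n" "map_mat \<sigma> Y2 = Y2 * map_mat \<iota> B" for \<sigma> A B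
  proof -
    have s0: "\<sigma> 0 = 0"
      by (rule differential_homD(5)[OF galois_hom[OF s big.K] big.F])
    show ?thesis
      by (simp add: map_four_block_diag[where f = \<sigma>, OF Yc Y2c s0] map_four_block_diag[OF A(1) B(1)]
          four_block_diag_mult Yc Y2c A B)
  qed
  have "(\<lambda>\<sigma>. restrict \<sigma> F1) -` galois_basic_open D \<iota> K F1 m Y P \<inter> galois D K F2
      = galois_basic_open D \<iota> K F2 (m + n) ?Y R"
  proof (intro equalityI subsetI)
    fix \<sigma> assume "\<sigma> \<in> (\<lambda>\<sigma>. restrict \<sigma> F1) -` galois_basic_open D \<iota> K F1 m Y P \<inter> galois D K F2"
    then obtain A where s: "\<sigma> \<in> galois D K F2" and A: "A \<in> carrier_mat m m"
      "map_mat \<sigma> Y = Y * map_mat \<iota> A" "P A \<noteq> 0"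
      by (auto simp: galois_basic_open_def map_restrict)
    obtain B where B: "B \<in> carrier_mat n n" "map_mat \<sigma> Y2 = Y2 * map_mat \<iota> B"
      using big.galois_matrix_exists[OF big.K big.F big.KF s Y2 el2] by blast
    show "\<sigma> \<in> galois_basic_open D \<iota> K F2 (m + n) ?Y R"
      using s block[OF s A(1,2) B] A(1,3) B(1) R(2) unfolding galois_basic_open_def
      by (auto intro!: bexI[of _ "?block A B"])
  next
    fix \<sigma> assume "\<sigma> \<in> galois_basic_open D \<iota> K F2 (m + n) ?Y R"
    then obtain C where s: "\<sigma> \<in> galois D K F2" and C: "C \<in> carrier_mat (m + n) (m + n)"
      "map_mat \<sigma> ?Y = ?Y * map_mat \<iota> C" "R C \<noteq> 0"
      by (auto simp: galois_basic_open_def)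
    have "elements_mat Y \<subseteq> F2"
      using el sub by blast
    then obtain A where A: "A \<in> carrier_mat m m" "map_mat \<sigma> Y = Y * map_mat \<iota> A"
      using big.galois_matrix_exists[OF big.K big.F big.KF s Y] by blast
    obtain B where B: "B \<in> carrier_mat n n" "map_mat \<sigma> Y2 = Y2 * map_mat \<iota> B"
      using big.galois_matrix_exists[OF big.K big.F big.KF s Y2 el2] by blast
    have "C = ?block A B"
      using block[OF s A B] C(1,2) A(1) B(1)
      by (intro big.galois_matrix_unique[OF Y3, of C "m + n"]) auto
    then have "P A \<noteq> 0"
      using R(2)[OF A(1) B(1)] C(3) by simp
    then show "\<sigma> \<in> (\<lambda>\<sigma>. restrict \<sigma> F1) -` galois_basic_open D \<iota> K F1 m Y P \<inter> galois D K F2"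
      using s restrict_in_galois[OF s] A by (auto simp: galois_basic_open_def map_restrict)
  qed
  then show "openin (zariski_gal D \<iota> K F2) ((\<lambda>\<sigma>. restrict \<sigma> F1) -` galois_basic_open D \<iota> K F1 m Y P
      \<inter> topspace (zariski_gal D \<iota> K F2))"
    using openin_galois_basic_open[OF fund3 R(1)] by (simp add: big.topspace_zariski)
qed

lemma restrict_component:
  assumes "\<sigma> \<in> galois_component D \<iota> K F2"
  shows "restrict \<sigma> F1 \<in> galois_component D \<iota> K F1"
proof -
  let ?r = "\<lambda>\<sigma>. restrict \<sigma> F1"
  have "connectedin (zariski_gal D \<iota> K F1) (?r ` galois_component D \<iota> K F2)"
    unfolding galois_component_def
    by (intro connectedin_continuous_map_image[OF continuous_restriction] connectedin_connected_component_of)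
  moreover have "(\<lambda>x\<in>F1. x) \<in> ?r ` galois_component D \<iota> K F2"
    using big.one_in_component sub by (intro image_eqI[of _ _ "\<lambda>x\<in>F2. x"]) (auto simp: inf_absorb2)
  ultimately have "?r ` galois_component D \<iota> K F2 \<subseteq> galois_component D \<iota> K F1"
    by (subst (2) galois_component_def) (rule connected_component_of_maximal)
  then show ?thesis using assms by blast
qed

end


section \<open>Solvability\<close>

lemma (in group) solvable_by_commutator_chain:
  assumes H: "\<And>q. q \<le> n \<Longrightarrow> subgroup (H q) G" and "H 0 = carrier G" and "H n = {\<one>}"
    and comm: "\<And>q x y. q < n \<Longrightarrow> x \<in> H q \<Longrightarrow> y \<in> H q \<Longrightarrow> x \<otimes> y \<otimes> inv x \<otimes> inv y \<in> H (Suc q)"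
  shows "solvable G"
proof -
  have "(derived G ^^ q) (carrier G) \<subseteq> H q" if "q \<le> n" for q
    using that
  proof (induction q)
    case 0
    then show ?case using assms(2) by simp
  next
    case (Suc q)
    have "(derived G ^^ Suc q) (carrier G) \<subseteq> derived G (H q)"
      using Suc by (simp add: mono_derived)
    also have "\<dots> \<subseteq> H (Suc q)"
      unfolding derived_def using comm[of q] Suc.prems
      by (intro generate_subgroup_incl[OF _ H]) auto
    finally show ?case .
  qed
  then have "(derived G ^^ n) (carrier G) \<subseteq> {\<one>}"
    using assms(3) by blast
  moreover have "\<one> \<in> (derived G ^^ n) (carrier G)"
    using exp_of_derived_is_subgroup[OF subgroup_self] subgroup.one_closed by blast
  ultimately show ?thesis
    unfolding solvable_iff_trivial_derived_seq by blast
qed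

context variational_equations
begin

lemma PV_VE_0: "PV_VE D K a 0 = K"
  unfolding PV_VE_def using adjoin_superset(1) adjoin_least[OF K order_refl] by (intro equalityI) auto

lemma picard_vessiot_extension_PV_VE: "picard_vessiot_extension D \<iota> K (PV_VE D K a p)"
  by unfold_locales (rule picard_vessiot_PV_VE range_iota)+

lemma picard_vessiot_tower_PV_VE:
  "q \<le> p \<Longrightarrow> picard_vessiot_tower D \<iota> K (PV_VE D K a q) (PV_VE D K a p)"
  by (intro picard_vessiot_tower.intro picard_vessiot_extension_PV_VE picard_vessiot_tower_axioms.intro
      PV_VE_mono)

text \<open>\<open>\<sigma> \<Phi> - \<Phi>\<close> has the derivative \<open>\<sigma> \<Phi>' - \<Phi>' = 0\<close>.\<close>

lemma automorphism_translates_integral: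
  assumes s: "\<sigma> \<in> galois D K (PV_VE D K a p)" and fixes_q: "\<And>x. x \<in> PV_VE D K a q \<Longrightarrow> \<sigma> x = x"
    and \<Phi>: "\<Phi> \<in> PV_VE D K a p" "D \<Phi> \<in> PV_VE D K a q"
  shows "\<exists>c. \<sigma> \<Phi> = \<Phi> + \<iota> c"
proof -
  have "\<sigma> (D \<Phi>) = D (\<sigma> \<Phi>)"
    by (rule differential_homD(3)[OF galois_hom[OF s K] diff_subfield_PV_VE \<Phi>(1)])
  then have "D (\<sigma> \<Phi> - \<Phi>) = 0"
    by (simp add: D_diff fixes_q[OF \<Phi>(2)])
  then obtain c where "\<sigma> \<Phi> - \<Phi> = \<iota> c"
    unfolding D_eq_0_iff by blast
  then have "\<sigma> \<Phi> = \<Phi> + \<iota> c"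
    by (simp add: algebra_simps)
  then show ?thesis by blast
qed

text \<open>Translations by constants commute, and the integrals generate the next extension.\<close>

lemma automorphisms_commute_one_level_up:
  assumes q: "1 \<le> q" "q < p" and s: "\<sigma> \<in> galois D K (PV_VE D K a p)" and t: "\<tau> \<in> galois D K (PV_VE D K a p)"
    and fixes_q: "\<And>x. x \<in> PV_VE D K a q \<Longrightarrow> \<sigma> x = x" "\<And>x. x \<in> PV_VE D K a q \<Longrightarrow> \<tau> x = x"
    and x: "x \<in> PV_VE D K a (Suc q)"
  shows "\<sigma> (\<tau> x) = \<tau> (\<sigma> x)"
proof -
  let ?F = "PV_VE D K a"
  let ?E = "{x \<in> ?F p. \<sigma> (\<tau> x) = \<tau> (\<sigma> x)}"
  have "?F (Suc q) \<subseteq> ?E"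
  proof (rule PV_VE_Suc_least[OF _ _ q(1)])
    show "diff_subfield D ?E"
      by (rule diff_subfield_equalizer[OF galois_hom_compose[OF s t K] galois_hom_compose[OF t s K]
            diff_subfield_PV_VE])
    show "?F q \<subseteq> ?E"
      using fixes_q PV_VE_mono[of q p] q(2) by auto
    fix y k assume y: "solves_VE D a (Suc q) y"
    let ?\<Phi> = "integral_coordinate (Suc q) y k"
    have \<Phi>: "?\<Phi> \<in> ?F p"
      using integral_coordinate_in_PV_VE[OF y] PV_VE_mono[of "Suc q" p] q(2) by auto
    have D\<Phi>: "D ?\<Phi> \<in> ?F q"
      using D_integral_coordinate_in_PV_ring[OF y q(1)] by (auto simp: PV_ring_def)
    obtain c where c: "\<sigma> ?\<Phi> = ?\<Phi> + \<iota> c"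
      using automorphism_translates_integral[OF s fixes_q(1) \<Phi> D\<Phi>] by blast
    obtain d where d: "\<tau> ?\<Phi> = ?\<Phi> + \<iota> d"
      using automorphism_translates_integral[OF t fixes_q(2) \<Phi> D\<Phi>] by blast
    have iota: "\<iota> e \<in> ?F p" for e
      using K_subset_PV_VE iota_in_K by blast
    have "\<sigma> (?\<Phi> + \<iota> d) = \<sigma> ?\<Phi> + \<iota> d" "\<tau> (?\<Phi> + \<iota> c) = \<tau> ?\<Phi> + \<iota> c"
      using differential_homD(1)[OF galois_hom[OF s K] diff_subfield_PV_VE \<Phi> iota]
        differential_homD(1)[OF galois_hom[OF t K] diff_subfield_PV_VE \<Phi> iota]
        galois_fixes[OF s iota_in_K] galois_fixes[OF t iota_in_K] by simp_all
    then show "?\<Phi> \<in> ?E"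
      using \<Phi> by (simp add: c d)
  qed
  then show ?thesis using x by blast
qed

text \<open>On elements \<open>\<tau> (\<sigma> w)\<close>, and these are all elements of \<open>PV(VE\<^sub>q)\<close>, the commutator has the value \<open>\<sigma> (\<tau> w)\<close>.\<close>

lemma commuting_automorphisms_commutator:
  fixes p q
  defines "G \<equiv> BijGroup (PV_VE D K a p)"
  assumes "q \<le> p" and s: "\<sigma> \<in> galois D K (PV_VE D K a p)" and t: "\<tau> \<in> galois D K (PV_VE D K a p)"
    and comm: "\<And>x. x \<in> PV_VE D K a q \<Longrightarrow> \<sigma> (\<tau> x) = \<tau> (\<sigma> x)" and z: "z \<in> PV_VE D K a q"
  shows "(\<sigma> \<otimes>\<^bsub>G\<^esub> \<tau> \<otimes>\<^bsub>G\<^esub> inv\<^bsub>G\<^esub> \<sigma> \<otimes>\<^bsub>G\<^esub> inv\<^bsub>G\<^esub> \<tau>) z = z"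
proof -
  interpret group G
    unfolding G_def by (rule group_BijGroup)
  interpret tower: picard_vessiot_tower D \<iota> K "PV_VE D K a q" "PV_VE D K a p"
    by (rule picard_vessiot_tower_PV_VE[OF \<open>q \<le> p\<close>])
  note bij = galois_Bij[OF s] galois_Bij[OF t]
  have car: "\<sigma> \<in> carrier G" "\<tau> \<in> carrier G"
    using bij by (simp_all add: G_def carrier_BijGroup)
  have mult: "(\<alpha> \<otimes>\<^bsub>G\<^esub> \<beta>) x = \<alpha> (\<beta> x)" if "\<alpha> \<in> carrier G" "\<beta> \<in> carrier G" "x \<in> PV_VE D K a p" for \<alpha> \<beta> x
    using that by (simp add: G_def carrier_BijGroup mult_BijGroup compose_eq)
  define \<gamma> where "\<gamma> = \<sigma> \<otimes>\<^bsub>G\<^esub> \<tau> \<otimes>\<^bsub>G\<^esub> inv\<^bsub>G\<^esub> \<sigma> \<otimes>\<^bsub>G\<^esub> inv\<^bsub>G\<^esub> \<tau>"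
  have \<gamma>: "\<gamma> \<in> carrier G"
    using car by (simp add: \<gamma>_def)
  have "\<gamma> \<otimes>\<^bsub>G\<^esub> (\<tau> \<otimes>\<^bsub>G\<^esub> \<sigma>) = \<sigma> \<otimes>\<^bsub>G\<^esub> \<tau>"
    unfolding \<gamma>_def using car by (simp add: m_assoc inv_solve_left flip: m_assoc[of "inv\<^bsub>G\<^esub> \<tau>"])
  have surj: "\<exists>y\<in>PV_VE D K a q. \<alpha> y = x" if "\<alpha> \<in> galois D K (PV_VE D K a p)" "x \<in> PV_VE D K a q" for \<alpha> x
  proof -
    have "\<alpha> ` PV_VE D K a q = PV_VE D K a q"
      using galois_Bij[OF tower.restrict_in_galois[OF that(1)]] by (simp add: Bij_def bij_betw_def)
    then show ?thesis
      using that(2) by (metis imageE)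
  qed
  obtain u where u: "u \<in> PV_VE D K a q" "\<tau> u = z"
    using surj[OF t z] by blast
  obtain w where w: "w \<in> PV_VE D K a q" "\<sigma> w = u"
    using surj[OF s u(1)] by blast
  have w': "w \<in> PV_VE D K a p"
    using w(1) tower.sub by blast
  have "\<gamma> z = (\<gamma> \<otimes>\<^bsub>G\<^esub> (\<tau> \<otimes>\<^bsub>G\<^esub> \<sigma>)) w"
    using mult[OF \<gamma> m_closed[OF car(2,1)] w'] mult[OF car(2,1) w'] u w by simp
  also have "\<dots> = \<sigma> (\<tau> w)"
    using \<open>\<gamma> \<otimes>\<^bsub>G\<^esub> (\<tau> \<otimes>\<^bsub>G\<^esub> \<sigma>) = \<sigma> \<otimes>\<^bsub>G\<^esub> \<tau>\<close> mult[OF car w'] by simp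
  also have "\<dots> = z"
    using comm[OF w(1)] u w by simp
  finally show ?thesis
    unfolding \<gamma>_def .
qed

text \<open>The chain of subgroups \<open>H q\<close> consists of the elements of the identity component that fix \<open>PV(VE\<^sub>q)\<close>; this is
  everything for \<open>q = 0\<close>,
  where the field is \<open>K\<close>, and trivial for \<open>q = p\<close>. The hypothesis on \<open>VE\<^sub>1\<close> gives the step from \<open>0\<close> to \<open>1\<close>, the
  integrals give the others.\<close>

theorem solvable_PV_VE:
  assumes abelian: "virtually_abelian_galois_group D \<iota> K (PV_VE D K a 1)" and p: "1 \<le> p"
  shows "solvable_picard_vessiot D \<iota> K (PV_VE D K a p)"
proof -
  let ?F = "PV_VE D K a"
  let ?S = "galois_component D \<iota> K (?F p)"
  define B where "B = BijGroup (?F p)"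
  define G where "G = B\<lparr>carrier := ?S\<rparr>"
  define H where "H q = {\<sigma> \<in> ?S. \<forall>x\<in>?F q. \<sigma> x = x}" for q
  interpret pv: picard_vessiot_extension D \<iota> K "?F p"
    by (rule picard_vessiot_extension_PV_VE)
  interpret B: group B
    unfolding B_def by (rule group_BijGroup)
  have S: "subgroup ?S B"
    unfolding B_def by (rule pv.component_subgroup)
  interpret G: group G
    unfolding G_def by (rule subgroup.subgroup_is_group[OF S B.group_axioms])
  have S_galois: "\<sigma> \<in> galois D K (?F p)" if "\<sigma> \<in> ?S" for \<sigma>
    using that pv.component_subset by blast
  have S_Bij: "\<sigma> \<in> Bij (?F p)" if "\<sigma> \<in> ?S" for \<sigma>
    using galois_Bij[OF S_galois[OF that]] .
  have inv_eq: "inv\<^bsub>G\<^esub> \<sigma> = inv\<^bsub>B\<^esub> \<sigma>" if "\<sigma> \<in> ?S" for \<sigma>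
    unfolding G_def by (rule B.m_inv_consistent[OF S that])
  have H_subgroup: "subgroup (H q) G" if "q \<le> p" for q
  proof (rule G.subgroupI)
    show "H q \<subseteq> carrier G"
      by (auto simp: H_def G_def)
    have "(\<lambda>x\<in>?F p. x) \<in> H q"
      using pv.one_in_component PV_VE_mono[OF that] by (auto simp: H_def)
    then show "H q \<noteq> {}" by blast
    fix \<sigma> assume s: "\<sigma> \<in> H q"
    then have sS: "\<sigma> \<in> ?S" by (simp add: H_def)
    have "inv_into (?F p) \<sigma> x = x" if x: "x \<in> ?F q" for x
    proof -
      have xp: "x \<in> ?F p"
        using x PV_VE_mono[OF \<open>q \<le> p\<close>] by blast
      then have "inv_into (?F p) \<sigma> (\<sigma> x) = x"
        using S_Bij[OF sS] by (intro inv_into_f_f) (auto simp: Bij_def bij_betw_def)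
      then show ?thesis
        using s x by (simp add: H_def)
    qed
    then show "inv\<^bsub>G\<^esub> \<sigma> \<in> H q"
      using G.inv_closed[of \<sigma>] sS PV_VE_mono[OF that]
      by (auto simp: H_def inv_eq[OF sS]) (auto simp: G_def inv_eq B_def inv_BijGroup[OF S_Bij[OF sS]])
    fix \<tau> assume t: "\<tau> \<in> H q"
    then have tS: "\<tau> \<in> ?S" by (simp add: H_def)
    have "\<sigma> \<otimes>\<^bsub>B\<^esub> \<tau> \<in> ?S"
      by (rule subgroup.m_closed[OF S sS tS])
    then show "\<sigma> \<otimes>\<^bsub>G\<^esub> \<tau> \<in> H q"
      using s t PV_VE_mono[OF that] mult_BijGroup[OF S_Bij[OF sS] S_Bij[OF tS]]
      by (auto simp: H_def G_def B_def compose_eq)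
  qed
  have commutator: "\<sigma> \<otimes>\<^bsub>G\<^esub> \<tau> \<otimes>\<^bsub>G\<^esub> inv\<^bsub>G\<^esub> \<sigma> \<otimes>\<^bsub>G\<^esub> inv\<^bsub>G\<^esub> \<tau> \<in> H (Suc q)"
    if q: "q < p" and s: "\<sigma> \<in> H q" and t: "\<tau> \<in> H q" for q \<sigma> \<tau>
  proof -
    have st: "\<sigma> \<in> ?S" "\<tau> \<in> ?S"
      and fix_s: "\<And>x. x \<in> ?F q \<Longrightarrow> \<sigma> x = x" and fix_t: "\<And>x. x \<in> ?F q \<Longrightarrow> \<tau> x = x"
      using s t by (auto simp: H_def)
    have "\<sigma> (\<tau> x) = \<tau> (\<sigma> x)" if x: "x \<in> ?F (Suc q)" for x
    proof (cases "q = 0")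
      case True
      interpret tower: picard_vessiot_tower D \<iota> K "?F 1" "?F p"
        by (rule picard_vessiot_tower_PV_VE[OF p])
      let ?s = "restrict \<sigma> (?F 1)" and ?t = "restrict \<tau> (?F 1)"
      have comps: "?s \<in> galois_component D \<iota> K (?F 1)" "?t \<in> galois_component D \<iota> K (?F 1)"
        by (rule tower.restrict_component[OF st(1)], rule tower.restrict_component[OF st(2)])
      have bijs: "?s \<in> Bij (?F 1)" "?t \<in> Bij (?F 1)"
        using st S_galois tower.restrict_in_galois galois_Bij by blast+
      interpret A: comm_group "identity_component D \<iota> K (?F 1)"
        using abelian unfolding virtually_abelian_galois_group_def .
      have "?s \<otimes>\<^bsub>BijGroup (?F 1)\<^esub> ?t = ?t \<otimes>\<^bsub>BijGroup (?F 1)\<^esub> ?s"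
        using A.m_comm[of ?s ?t] comps by (simp add: identity_component_eq)
      then have "compose (?F 1) ?s ?t = compose (?F 1) ?t ?s"
        by (simp only: mult_BijGroup[OF bijs] mult_BijGroup[OF bijs(2,1)])
      then have "compose (?F 1) ?s ?t x = compose (?F 1) ?t ?s x"
        by simp
      then show ?thesis
        using x True tower.galois_preserves[OF S_galois[OF st(1)]] tower.galois_preserves[OF S_galois[OF st(2)]]
        by (simp add: compose_eq)
    next
      case False
      then show ?thesis
        using automorphisms_commute_one_level_up[OF _ q S_galois[OF st(1)] S_galois[OF st(2)] fix_s fix_t x]
        by simp
    qed
    then have "(\<sigma> \<otimes>\<^bsub>B\<^esub> \<tau> \<otimes>\<^bsub>B\<^esub> inv\<^bsub>B\<^esub> \<sigma> \<otimes>\<^bsub>B\<^esub> inv\<^bsub>B\<^esub> \<tau>) z = z" if "z \<in> ?F (Suc q)" for z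
      unfolding B_def
      by (intro commuting_automorphisms_commutator[OF _ S_galois[OF st(1)] S_galois[OF st(2)] _ that])
         (use q in auto)
    moreover have "\<sigma> \<otimes>\<^bsub>G\<^esub> \<tau> \<otimes>\<^bsub>G\<^esub> inv\<^bsub>G\<^esub> \<sigma> \<otimes>\<^bsub>G\<^esub> inv\<^bsub>G\<^esub> \<tau> \<in> carrier G"
      using st by (intro G.m_closed G.inv_closed) (auto simp: G_def)
    ultimately show ?thesis
      using inv_eq[OF st(1)] inv_eq[OF st(2)] by (simp add: H_def G_def)
  qed
  have "H 0 = carrier G"
    using galois_fixes[OF S_galois] by (auto simp: H_def G_def PV_VE_0)
  moreover have "H p = {\<one>\<^bsub>G\<^esub>}"
  proof -
    have "\<sigma> = (\<lambda>x\<in>?F p. x)" if "\<sigma> \<in> H p" for \<sigma>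
      using that S_Bij[of \<sigma>] by (intro Bij_eqI[OF _ id_Bij]) (auto simp: H_def)
    moreover have "(\<lambda>x\<in>?F p. x) \<in> H p"
      using pv.one_in_component by (simp add: H_def)
    ultimately have "H p = {\<lambda>x\<in>?F p. x}"
      by blast
    then show ?thesis
      by (simp add: G_def B_def one_BijGroup)
  qed
  ultimately have "solvable G"
    using H_subgroup commutator by (intro G.solvable_by_commutator_chain[of p H])
  then show ?thesis
    unfolding solvable_picard_vessiot_def identity_component_eq using picard_vessiot_PV_VE
    by (simp add: G_def B_def)
qed

end

theorem lemma2p2:
  fixes H :: "complex ^ ('n::finite + 'n) \<Rightarrow> complex"
    and U :: "(complex ^ ('n + 'n)) set"
    and \<Omega> :: "complex set"
    and x0 :: "complex \<Rightarrow> complex ^ ('n + 'n)"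
    and D :: "'a::field_char_0 \<Rightarrow> 'a"
    and \<iota> :: "complex \<Rightarrow> 'a"
    and K :: "'a set"
    and R :: "(complex \<Rightarrow> complex) set"
    and \<phi> :: "(complex \<Rightarrow> complex) \<Rightarrow> 'a"
    and a :: "('n + 'n) list \<Rightarrow> 'n + 'n \<Rightarrow> 'a"
  assumes "open U" and "cholomorphic_on H U"
    and "particular_solution (hamiltonian_field H) U \<Omega> x0"
    and "derivation D" and "field_hom \<iota>" and "constants D = range \<iota>"
    and "diff_subfield D K" and "range \<iota> \<subseteq> K"
    and "differential_embedding \<Omega> D \<iota> K R \<phi>"
    and "\<And>js i. js \<noteq> [] \<Longrightarrow> pderiv_along (hamiltonian_field H) x0 js i \<in> R"
    and "\<And>js i. a js i = \<phi> (pderiv_along (hamiltonian_field H) x0 js i)"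
    and "contains_all_solutions D a"
    and "virtually_abelian_galois_group D \<iota> K (PV_VE D K a 1)"
  shows "\<forall>p\<ge>1. generated_by_second_level_integrals D K (PV_VE D K a p) (PV_VE D K a (Suc p)) \<and>
               solvable_picard_vessiot D \<iota> K (PV_VE D K a p)"
proof -
  have "a js i \<in> K" if "js \<noteq> []" for js i
    using assms(9,10,11) that unfolding differential_embedding_def by auto
  then interpret variational_equations D \<iota> K a
    by (intro variational_equations.intro differential_field.intro variational_equations_axioms.intro)
       (use assms(4-8,12) in auto)
  show ?thesis
    using generated_by_second_level_integrals_PV_VE solvable_PV_VE[OF assms(13)] by blast
qed

end
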